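(* Let $\mathbb{K}=\mathbb{Z}$, $\mathbb{Q}$ or $\mathbb{R}$, let $X\sim N(0,1)$, let $p\ge 2$, and let $Y=H_p(X)$, where $H_p$ is the (probabilists') Hermite polynomial of degree $p$. Let $\mathcal{S}=\sum_{t=0}^T p_t\partial^t\in PSO(Y)=APSO(Y)$ be a polynomial Stein operator for $Y$ of order $T$ (so $p_T\not\equiv 0$), with coefficients $p_t\in\mathbb{K}[y]$. Identify the variable $y=H_p(x)$, so that $\mathbb{K}[y]\cong\mathbb{K}[H_p(x)]$ is a subring of $\mathbb{K}[x]$, and let $\langle H_p'(x)\rangle$ be the ideal of $\mathbb{K}[x]$ generated by $H_p'(x)$. Then: (a) $\mathbb{K}[y]\cap\langle H_p'(x)\rangle$ is an ideal of the subring $\mathbb{K}[y]$. Moreover, $$\mathbb{K}[y]\cap\langle H_p'(x)\rangle=\langle t(y)\rangle\qquad\text{with}\qquad t(y)=\prod_{z:\,H_p'(z)=0}\bigl(y-H_p(z)\bigr),$$ where the product is over all zeros $z$ of $H_p'$ and $\langle t(y)\rangle$ is the ideal of $\mathbb{K}[y]$ generated by $t(y)$. (b) $p_T(y)\in\mathbb{K}[y]\cap\langle H_p'(x)\rangle$, and $p_T(H_p(x))=0$ for all solutions $x$ of $H_p'(x)=0$. In particular, $p_T(y)=0$ at all local minimum or local maximum values $y$ of $H_p$. (c) $\deg(p_T)\ge p/2$ if $p$ is even, and $\deg(p_T)\ge p-1$ if $p$ is odd.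
   Context: Hermite polynomials: $H_0(x)=1$, $H_n(x)=xH_{n-1}(x)-H_{n-1}'(x)$ for $n\ge1$ (so $H_n'=nH_{n-1}$). Under the identification $y=H_p(x)$, a polynomial $q(y)\in\mathbb{K}[y]$ belongs to $\mathbb{K}[y]\cap\langle H_p'(x)\rangle$ if and only if $q(H_p(x))$ is divisible by $H_p'(x)$ in $\mathbb{K}[x]$. Polynomial Stein operators: let $\mathcal{S}=\sum_{t=0}^T p_t(y)\partial^t$ be a linear differential operator with polynomial coefficients $p_t\in\mathbb{K}[y]$ ($\partial$ is differentiation, $\partial^0$ the identity), let $m=\max_t\deg p_t$, and let $I\subseteq\mathbb{R}$ be the support of $Y$. Let $\mathcal{F}_{\mathcal{S},Y}$ be the set of all $f\in C^T(I)$ with $\mathbb{E}|Y^jf^{(t)}(Y)|<\infty$ for all $t=0,\dots,T$ and $j=0,\dots,m$. Then $\mathcal{S}\in PSO(Y)$ ($\mathcal{S}$ is a polynomial Stein operator for $Y$) means that $\mathcal{S}f(Y)\in L^1$ and $\mathbb{E}[\mathcal{S}f(Y)]=0$ for all $f\in\mathcal{F}_{\mathcal{S},Y}$. Algebraic polynomial Stein operators: let $\delta^{-1}$ be the linear map on $\mathbb{K}[x]$ with $\delta^{-1}H_0=0$ and $\delta^{-1}H_n=H_{n-1}$ for $n\ge1$, and let $\Gamma_Y(f(X))=H_p'(X)\,(\delta^{-1}f)(X)$ for $f\in\mathbb{K}[x]$. An operator $\mathcal{S}=\sum_{t=0}^T p_t\partial^t\in PSO(Y)$, $T\ge1$, belongs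 to $APSO(Y)$ if the sequence defined by $g_0=0$, $g_t=\Gamma_Y(g_{t-1}+p_{t-1}(Y))$ for $t=1,\dots,T$, satisfies $\mathbb{E}[g_t]=-\mathbb{E}[p_t(Y)]$ for $t=0,\dots,T$ and $g_T+p_T(Y)=0$ almost surely. For targets that are polynomials of a single standard Gaussian variable, the paper shows $PSO(Y)=APSO(Y)$.
   Formalization: In (a), t(y) is the product over the distinct values H_p(z), since with one factor per zero the claim fails for even p≥4 (e.g. p=4); for K=Z the generator is p·t(y), since t(y) is not in <H_p'(x)> over Z (e.g. p=2: x^2 is not in <2x>). *)

theory Defs
  imports
    "HOL-Probability.Probability"
    "HOL-Computational_Algebra.Polynomial"
    "HOL-Algebra.Ideal"
begin

primrec hermite :: "nat \<Rightarrow> real poly" where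
  "hermite 0 = 1"
| "hermite (Suc n) = [:0, 1:] * hermite n - pderiv (hermite n)"


subsection \<open>Ideals in polynomial rings over a subring of the reals\<close>

text \<open>
  For a subring \<open>K\<close> of the reals, \<open>K[x]\<close> is rendered as the set of real polynomials with all
  coefficients in \<open>K\<close>, packaged as a ring record so that the ideals of HOL-Algebra apply.
\<close>

definition poly_ring :: "real set \<Rightarrow> real poly ring" where
  "poly_ring K = \<lparr>carrier = {q. \<forall>i. coeff q i \<in> K}, mult = (*), one = 1, zero = 0, add = (+)\<rparr>"

text \<open>
  \<open>critical_ideal K p\<close> is the intersection of \<open>K[y]\<close> with the ideal of \<open>K[x]\<close> generated by \<open>H\<^sub>p'\<close>,
  where \<open>q(y)\<close> in \<open>K[y]\<close> is identified with \<open>q(H\<^sub>p(x))\<close> in \<open>K[x]\<close>.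
\<close>

definition critical_ideal :: "real set \<Rightarrow> nat \<Rightarrow> real poly set" where
  "critical_ideal K p =
     {q \<in> carrier (poly_ring K).
        pcompose q (hermite p) \<in> Idl\<^bsub>poly_ring K\<^esub> {pderiv (hermite p)}}"

text \<open>
  The product runs over the distinct values \<open>H\<^sub>p(z)\<close>: for even \<open>p\<close> the zeros \<open>z\<close> and \<open>-z\<close> of \<open>H\<^sub>p'\<close>
  give the same value, which contributes one factor only.  Over the integers this polynomial does not
  lie in \<open>critical_ideal\<close>: every element of the ideal generated by \<open>H\<^sub>p' = p H\<^bsub>p-1\<^esub>\<close> has content
  divisible by \<open>p\<close>, so \<open>p\<close> times this polynomial takes its place.
\<close>

definition critical_poly :: "nat \<Rightarrow> real poly" where
  "critical_poly p = (\<Prod>w \<in> poly (hermite p) ` {z. poly (pderiv (hermite p)) z = 0}. [:- w, 1:])"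


subsection \<open>Polynomial Stein operators\<close>

definition rv_support :: "'a measure \<Rightarrow> ('a \<Rightarrow> real) \<Rightarrow> real set" where
  "rv_support M Y = {y. \<forall>e>0. measure M {\<omega> \<in> space M. Y \<omega> \<in> ball y e} > 0}"

text \<open>
  Derivatives are taken within \<open>I\<close>, hence are one-sided at an end point of \<open>I\<close>.
\<close>

primrec higher_deriv_on :: "real set \<Rightarrow> nat \<Rightarrow> (real \<Rightarrow> real) \<Rightarrow> real \<Rightarrow> real" where
  "higher_deriv_on I 0 f = f"
| "higher_deriv_on I (Suc t) f =
     (\<lambda>y. vector_derivative (higher_deriv_on I t f) (at y within I))"

definition C_on :: "nat \<Rightarrow> real set \<Rightarrow> (real \<Rightarrow> real) set" where
  "C_on T I = {f. (\<forall>t<T. higher_deriv_on I t f differentiable_on I) \<and>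
                  continuous_on I (higher_deriv_on I T f)}"

text \<open>
  A differential operator of order at most \<open>T\<close> is given by its coefficients
  \<open>c 0, \<dots>, c T\<close>; values \<open>c t\<close> with \<open>t > T\<close> are ignored.
\<close>

definition apply_op :: "real set \<Rightarrow> nat \<Rightarrow> (nat \<Rightarrow> real poly) \<Rightarrow> (real \<Rightarrow> real) \<Rightarrow> real \<Rightarrow> real" where
  "apply_op I T c f y = (\<Sum>t\<le>T. poly (c t) y * higher_deriv_on I t f y)"

definition stein_class ::
    "'a measure \<Rightarrow> ('a \<Rightarrow> real) \<Rightarrow> nat \<Rightarrow> (nat \<Rightarrow> real poly) \<Rightarrow> (real \<Rightarrow> real) set" where
  "stein_class M Y T c =
     {f \<in> C_on T (rv_support M Y).
        \<forall>t\<le>T. \<forall>j \<le> Max ((\<lambda>s. degree (c s)) ` {..T}).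
          integrable M (\<lambda>\<omega>. Y \<omega> ^ j * higher_deriv_on (rv_support M Y) t f (Y \<omega>))}"

definition PSO ::
    "'a measure \<Rightarrow> ('a \<Rightarrow> real) \<Rightarrow> nat \<Rightarrow> (nat \<Rightarrow> real poly) \<Rightarrow> bool" where
  "PSO M Y T c \<longleftrightarrow>
     (\<forall>f \<in> stein_class M Y T c.
        integrable M (\<lambda>\<omega>. apply_op (rv_support M Y) T c f (Y \<omega>)) \<and>
        (\<integral>\<omega>. apply_op (rv_support M Y) T c f (Y \<omega>) \<partial>M) = 0)"

end

theory Submission
  imports "Jordan_Normal_Form.Char_Poly" "HOL-Real_Asymp.Real_Asymp" Defs
begin

hide_const (open) Module.smult

text \<open>
  Part (a). The zeros of \<open>H\<^sub>p' = p H\<^sub>p\<^sub>-\<^sub>1\<close> are real and simple, so \<open>H\<^sub>p\<^sub>-\<^sub>1\<close> divides \<open>q(H\<^sub>p)\<close> iff \<open>q\<close>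
  vanishes at the critical values, that is, iff \<open>critical_poly p\<close> divides \<open>q\<close>. This polynomial has
  integer coefficients because it is the characteristic polynomial of multiplication by \<open>H\<^sub>p\<close> on
  \<open>\<int>[x] / (H\<^sub>p\<^sub>-\<^sub>1)\<close>; for even \<open>p\<close>, where critical values coincide in pairs, one passes to the variable
  \<open>x\<^sup>2\<close> first.

  Parts (b), (c). Repeated Gaussian integration by parts turns \<open>E[S f(Y)] = 0\<close> into
  \<open>(\<Sum>t<T. m\<^sub>t E[f\<^sup>(\<^sup>t\<^sup>)(Y)]) + E[G(X) f\<^sup>(\<^sup>T\<^sup>)(Y)] = 0\<close> with constants \<open>m\<^sub>t\<close> and a polynomial
  \<open>G \<in> p\<^sub>T(H\<^sub>p) + \<langle>H\<^sub>p'\<rangle>\<close>. Monomials \<open>f\<close> show \<open>m\<^sub>t = 0\<close>. Taking \<open>f\<^sup>(\<^sup>T\<^sup>)(y) = (y - R)\<^sub>+\<close> with \<open>R\<close> large gives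
  \<open>G = 0\<close>: the event \<open>Y > R\<close> forces \<open>X\<close> to be large if \<open>p\<close> is odd, and \<open>|X|\<close> to be large with \<open>G\<close> even
  if \<open>p\<close> is even, so \<open>G(X)\<close> has a constant sign on it. The degree bound counts the critical values.
\<close>

subsection \<open>Polynomials over a subring of the reals\<close>

lemma prod_linear_factors_dvd:
  fixes q :: "real poly"
  assumes "finite W" "\<And>w. w \<in> W \<Longrightarrow> poly q w = 0"
  shows "(\<Prod>w\<in>W. [:- w, 1:]) dvd q"
  using assms
proof (induction W arbitrary: q rule: finite_induct)
  case (insert a W)
  have "poly q a = 0"
    using insert.prems by simp
  then obtain s where s: "q = [:- a, 1:] * s"
    by (auto simp: poly_eq_0_iff_dvd)
  have "(\<Prod>w\<in>W. [:- w, 1:]) dvd s"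
  proof (rule insert.IH)
    fix w assume "w \<in> W"
    then show "poly s w = 0"
      using insert.prems[of w] insert.hyps s by auto
  qed
  then show ?case
    using insert.hyps s by (simp add: mult_dvd_mono del: mult_pCons_left)
qed simp

lemma monic_prod_linear_factors:
  "lead_coeff (\<Prod>w\<in>W. [:- w, 1:] :: real poly) = 1"
  by (simp add: lead_coeff_prod)

lemma degree_prod_linear_factors:
  "degree (\<Prod>w\<in>W. [:- w, 1:] :: real poly) = card W"
  by (subst degree_prod_eq_sum_degree) auto

lemma poly_prod_linear_factors:
  "finite W \<Longrightarrow> poly (\<Prod>w\<in>W. [:- w, 1:]) (y :: real) = 0 \<longleftrightarrow> y \<in> W"
  by (auto simp: poly_prod)

text \<open>Root counting yields one divisibility only; comparing degrees and leading coefficients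
  upgrades it to equality, both for a characteristic polynomial and for
  \<open>hermite n\<close>.\<close>

lemma monic_dvd_imp_eq:
  fixes f g :: "real poly"
  assumes "f dvd g" "degree f = degree g" "lead_coeff f = 1" "lead_coeff g = 1"
  shows "f = g"
proof -
  obtain s where s: "g = f * s"
    using assms(1) by auto
  have "f \<noteq> 0" "s \<noteq> 0"
    using assms s by auto
  then have "degree s = 0"
    using assms(2) s by (simp add: degree_mult_eq)
  then obtain a where "s = [:a:]"
    using degree_eq_zeroE by blast
  then show ?thesis
    using assms s by simp
qed

lemma degree_eqI_coeff: "coeff s n \<noteq> 0 \<Longrightarrow> (\<And>i. i > n \<Longrightarrow> coeff s i = 0) \<Longrightarrow> degree s = n"
  by (meson antisym degree_le le_degree)

text \<open>Treats \<int>, \<rat> and \<real> uniformly. Arguments in this locale divide only by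
  monic polynomials, unless an inverse is assumed to lie in \<open>K\<close>.\<close>

locale real_subring =
  fixes K :: "real set"
  assumes one_mem: "1 \<in> K"
    and diff_mem: "a \<in> K \<Longrightarrow> b \<in> K \<Longrightarrow> a - b \<in> K"
    and mult_mem: "a \<in> K \<Longrightarrow> b \<in> K \<Longrightarrow> a * b \<in> K"
begin

abbreviation "polys \<equiv> carrier (poly_ring K)"

lemma zero_mem: "0 \<in> K"
  using diff_mem[OF one_mem one_mem] by simp

lemma uminus_mem: "a \<in> K \<Longrightarrow> - a \<in> K"
  using diff_mem[OF zero_mem, of a] by simp

lemma add_mem: "a \<in> K \<Longrightarrow> b \<in> K \<Longrightarrow> a + b \<in> K"
  using diff_mem[OF _ uminus_mem, of a b] by simp

lemma sum_mem: "(\<And>i. i \<in> A \<Longrightarrow> f i \<in> K) \<Longrightarrow> sum f A \<in> K"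
  by (induction A rule: infinite_finite_induct) (auto intro: zero_mem add_mem)

lemma of_nat_mem: "of_nat n \<in> K"
  by (induction n) (auto intro: zero_mem one_mem add_mem)

lemma polys_iff: "q \<in> polys \<longleftrightarrow> (\<forall>i. coeff q i \<in> K)"
  by (simp add: poly_ring_def)

lemma polys_0: "0 \<in> polys"
  by (simp add: polys_iff zero_mem)

lemma polys_pCons: "a \<in> K \<Longrightarrow> q \<in> polys \<Longrightarrow> pCons a q \<in> polys"
  by (auto simp: polys_iff coeff_pCons split: nat.split)

lemma polys_1: "1 \<in> polys"
  unfolding one_pCons by (intro polys_pCons polys_0 one_mem)

lemma polys_add: "q \<in> polys \<Longrightarrow> r \<in> polys \<Longrightarrow> q + r \<in> polys"
  by (simp add: polys_iff add_mem)

lemma polys_uminus: "q \<in> polys \<Longrightarrow> - q \<in> polys"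
  by (simp add: polys_iff uminus_mem)

lemma polys_diff: "q \<in> polys \<Longrightarrow> r \<in> polys \<Longrightarrow> q - r \<in> polys"
  by (simp add: polys_iff diff_mem)

lemma polys_mult: "q \<in> polys \<Longrightarrow> r \<in> polys \<Longrightarrow> q * r \<in> polys"
  by (auto simp: polys_iff coeff_mult intro!: sum_mem mult_mem)

lemma polys_smult: "a \<in> K \<Longrightarrow> q \<in> polys \<Longrightarrow> smult a q \<in> polys"
  by (simp add: polys_iff mult_mem)

lemma polys_monom: "a \<in> K \<Longrightarrow> monom a n \<in> polys"
  by (simp add: polys_iff zero_mem)

lemma polys_sum: "(\<And>i. i \<in> A \<Longrightarrow> f i \<in> polys) \<Longrightarrow> sum f A \<in> polys"
  by (induction A rule: infinite_finite_induct) (auto intro: polys_0 polys_add)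

lemma polys_prod: "(\<And>i. i \<in> A \<Longrightarrow> f i \<in> polys) \<Longrightarrow> prod f A \<in> polys"
  by (induction A rule: infinite_finite_induct) (auto intro: polys_1 polys_mult)

lemma polys_pderiv: "q \<in> polys \<Longrightarrow> pderiv q \<in> polys"
  unfolding polys_iff coeff_pderiv using of_nat_mem mult_mem by blast

lemma polys_pcompose: "q \<in> polys \<Longrightarrow> r \<in> polys \<Longrightarrow> pcompose q r \<in> polys"
proof (induction q)
  case (pCons a q)
  have a: "a \<in> K" and q: "q \<in> polys"
    using pCons.prems by (auto simp: polys_iff coeff_pCons split: nat.splits)
  then show ?case
    using pCons by (auto simp: pcompose_pCons intro!: polys_add polys_mult polys_pCons polys_0)
qed (simp add: polys_0)

lemma cring_poly_ring: "cring (poly_ring K)"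
proof (rule cringI)
  show "abelian_group (poly_ring K)"
  proof (rule abelian_groupI)
    fix x assume "x \<in> polys"
    then show "\<exists>y\<in>polys. y \<oplus>\<^bsub>poly_ring K\<^esub> x = \<zero>\<^bsub>poly_ring K\<^esub>"
      by (intro bexI[of _ "- x"]) (simp_all add: polys_uminus, simp add: poly_ring_def)
  qed (use polys_add polys_0 in \<open>auto simp: poly_ring_def\<close>)
  show "comm_monoid (poly_ring K)"
    by (rule comm_monoidI) (use polys_mult polys_1 in \<open>auto simp: poly_ring_def\<close>)
qed (simp add: poly_ring_def algebra_simps)

lemma genideal_poly_ring:
  assumes "a \<in> polys"
  shows "Idl\<^bsub>poly_ring K\<^esub> {a} = {a * s | s. s \<in> polys}"
proof -
  interpret cring "poly_ring K"
    by (rule cring_poly_ring)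
  have "Idl\<^bsub>poly_ring K\<^esub> {a} = PIdl\<^bsub>poly_ring K\<^esub> a"
    using cgenideal_eq_genideal assms by simp
  then show ?thesis
    by (auto simp: cgenideal_def poly_ring_def mult.commute)
qed

text \<open>The leading coefficient of \<open>f * s\<close> is that of \<open>s\<close>, so it lies
  in \<open>K\<close>; removing the leading term of \<open>s\<close> leaves a shorter
  cofactor.\<close>

lemma polys_divide_monic:
  assumes f: "f \<in> polys" "lead_coeff f = 1" and fs: "f * s \<in> polys"
  shows "s \<in> polys"
proof -
  \<comment> \<open>Bounding the indices of nonzero coefficients by \<open>n\<close>, instead of
    fixing the degree, makes the zero polynomial the base case.\<close>
  have "\<forall>s. (\<forall>i\<ge>n. coeff s i = 0) \<longrightarrow> f * s \<in> polys \<longrightarrow> s \<in> polys" for n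
  proof (induction n)
    case 0
    then show ?case
      by (auto simp: polys_iff zero_mem)
  next
    case (Suc n)
    show ?case
    proof (intro allI impI)
      fix s assume s: "\<forall>i\<ge>Suc n. coeff s i = 0" and fs: "f * s \<in> polys"
      show "s \<in> polys"
      proof (cases "coeff s n = 0")
        case True
        then have "\<forall>i\<ge>n. coeff s i = 0"
          using s by (metis le_antisym not_less_eq_eq)
        then show ?thesis
          using Suc fs by blast
      next
        case False
        then have "degree s = n"
          using s by (intro degree_eqI_coeff) auto
        then have "lead_coeff (f * s) = coeff s n"
          using f by (simp add: lead_coeff_mult)
        then have m: "monom (coeff s n) n \<in> polys"
          using fs by (metis polys_iff polys_monom)
        have "\<forall>i\<ge>n. coeff (s - monom (coeff s n) n) i = 0"
          using s by (auto simp: le_Suc_eq Suc_le_eq)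
        moreover have "f * (s - monom (coeff s n) n) \<in> polys"
          using polys_diff[OF fs polys_mult[OF f(1) m]] by (simp add: algebra_simps)
        ultimately have "s - monom (coeff s n) n \<in> polys"
          using Suc by blast
        from polys_add[OF this m] show ?thesis
          by simp
      qed
    qed
  qed
  from this[of "Suc (degree s)"] fs show ?thesis
    by (auto simp: coeff_eq_0)
qed

text \<open>Since \<open>h\<close> is monic and nonconstant, the leading coefficient of
  \<open>pcompose q h\<close> is that of \<open>q\<close>, and the leading terms of \<open>q\<close>
  can be peeled off one by one.\<close>

lemma polys_pcompose_monicD:
  assumes h: "h \<in> polys" "lead_coeff h = 1" "degree h > 0" and qh: "pcompose q h \<in> polys"
  shows "q \<in> polys"
proof -
  have "\<forall>q. (\<forall>i\<ge>n. coeff q i = 0) \<longrightarrow> pcompose q h \<in> polys \<longrightarrow> q \<in> polys" for n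
  proof (induction n)
    case 0
    then show ?case
      by (auto simp: polys_iff zero_mem)
  next
    case (Suc n)
    show ?case
    proof (intro allI impI)
      fix q assume q: "\<forall>i\<ge>Suc n. coeff q i = 0" and qh: "pcompose q h \<in> polys"
      show "q \<in> polys"
      proof (cases "coeff q n = 0")
        case True
        then have "\<forall>i\<ge>n. coeff q i = 0"
          using q by (metis le_antisym not_less_eq_eq)
        then show ?thesis
          using Suc qh by blast
      next
        case False
        then have "degree q = n"
          using q by (intro degree_eqI_coeff) auto
        then have "lead_coeff (pcompose q h) = coeff q n"
          using h by (subst lead_coeff_comp) auto
        then have m: "monom (coeff q n) n \<in> polys"
          using qh by (metis polys_iff polys_monom)
        have "\<forall>i\<ge>n. coeff (q - monom (coeff q n) n) i = 0"
          using q by (auto simp: le_Suc_eq Suc_le_eq)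
        moreover have "pcompose (q - monom (coeff q n) n) h \<in> polys"
          using polys_diff[OF qh polys_pcompose[OF m h(1)]] by (simp add: pcompose_diff)
        ultimately have "q - monom (coeff q n) n \<in> polys"
          using Suc by blast
        from polys_add[OF this m] show ?thesis
          by simp
      qed
    qed
  qed
  from this[of "Suc (degree q)"] qh show ?thesis
    by (auto simp: coeff_eq_0)
qed

text \<open>Long division by a monic divisor never divides coefficients. The remainder is described
  by its vanishing coefficients so that a divisor of degree 0 is covered as well.\<close>

lemma polys_mod_monic:
  assumes f: "f \<in> polys" "lead_coeff f = 1" and g: "g \<in> polys"
  obtains q r where "q \<in> polys" "r \<in> polys" "g = q * f + r" "\<And>i. i \<ge> degree f \<Longrightarrow> coeff r i = 0"
proof -
  define d where "d = degree f"
  have "\<forall>g\<in>polys. (\<forall>i\<ge>d + n. coeff g i = 0) \<longrightarrow>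
      (\<exists>q\<in>polys. \<exists>r\<in>polys. g = q * f + r \<and> (\<forall>i\<ge>d. coeff r i = 0))" for n
  proof (induction n)
    case 0
    have "\<exists>q\<in>polys. \<exists>r\<in>polys. g = q * f + r \<and> (\<forall>i\<ge>d. coeff r i = 0)"
      if "g \<in> polys" "\<forall>i\<ge>d. coeff g i = 0" for g
      using that polys_0 by (intro bexI[of _ 0] bexI[of _ g]) auto
    then show ?case
      by simp
  next
    case (Suc n)
    show ?case
    proof (intro ballI impI)
      fix g assume g: "g \<in> polys" "\<forall>i\<ge>d + Suc n. coeff g i = 0"
      define m where "m = monom (coeff g (d + n)) n"
      have m: "m \<in> polys"
        unfolding m_def using g(1) by (intro polys_monom) (simp add: polys_iff)
      have "coeff (m * f) i = (if i < n then 0 else coeff g (d + n) * coeff f (i - n))" for i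
        by (simp add: m_def coeff_monom_mult)
      then have "coeff (g - m * f) i = 0" if "i = d + n \<or> i \<ge> d + Suc n" for i
        using that g(2) f(2) by (auto simp: d_def coeff_eq_0)
      then have "\<forall>i\<ge>d + n. coeff (g - m * f) i = 0"
        by (metis add_Suc_right le_antisym not_less_eq_eq)
      moreover have "g - m * f \<in> polys"
        using g m f by (intro polys_diff polys_mult)
      ultimately obtain q r where qr: "q \<in> polys" "r \<in> polys" "g - m * f = q * f + r"
          "\<forall>i\<ge>d. coeff r i = 0"
        using Suc by blast
      have "g = (q + m) * f + r"
        using qr(3) by (simp add: algebra_simps)
      then show "\<exists>q\<in>polys. \<exists>r\<in>polys. g = q * f + r \<and> (\<forall>i\<ge>d. coeff r i = 0)"
        using qr m polys_add by metis
    qed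
  qed
  from this[of "Suc (degree g)"] g that show ?thesis
    by (auto simp: d_def coeff_eq_0)
qed

lemma polys_char_poly:
  assumes A: "A \<in> carrier_mat n n" and K: "\<And>i j. i < n \<Longrightarrow> j < n \<Longrightarrow> A $$ (i, j) \<in> K"
  shows "char_poly A \<in> polys"
proof -
  let ?C = "char_poly_matrix A"
  have C: "?C \<in> carrier_mat n n"
    using A by simp
  have entries: "?C $$ (i, j) \<in> polys" if "i < n" "j < n" for i j
    using that A K[OF that]
    by (auto simp: char_poly_matrix_def intro!: polys_pCons polys_0 polys_1 polys_add one_mem uminus_mem zero_mem)
  have "signof \<pi> * (\<Prod>i = 0..<n. ?C $$ (i, \<pi> i)) \<in> polys" if "\<pi> permutes {0..<n}" for \<pi>
  proof -
    have "(\<Prod>i = 0..<n. ?C $$ (i, \<pi> i)) \<in> polys"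
      using that permutes_in_image[OF that] by (intro polys_prod entries) auto
    then show ?thesis
      by (auto simp: sign_def polys_uminus)
  qed
  then show ?thesis
    unfolding char_poly_def det_def'[OF C] by (intro polys_sum) auto
qed

text \<open>
  The values of \<open>g\<close> at the roots of \<open>f\<close> are the eigenvalues of multiplication by \<open>g\<close> on
  \<open>K[x] / (f)\<close>, whose matrix in the basis \<open>1, x, \<dots>\<close> has entries in \<open>K\<close>.
\<close>

lemma polys_prod_root_values:
  assumes f: "f \<in> polys" "lead_coeff f = 1" "degree f > 0" and g: "g \<in> polys"
    and S: "card S = degree f" "\<And>z. z \<in> S \<Longrightarrow> poly f z = 0" "inj_on (poly g) S"
  shows "(\<Prod>w\<in>poly g ` S. [:- w, 1:]) \<in> polys"
proof -
  define n where "n = degree f"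
  have finS: "finite S"
    using S(1) f(3) card_ge_0_finite by force
  have "\<exists>q r. r \<in> polys \<and> g * monom 1 j = q * f + r \<and> (\<forall>i\<ge>n. coeff r i = 0)" for j
    using polys_mod_monic[OF f(1,2), of "g * monom 1 j"] polys_mult[OF g polys_monom[OF one_mem]]
    unfolding n_def by metis
  then obtain q r where qr: "\<And>j. r j \<in> polys" "\<And>j. g * monom 1 j = q j * f + r j"
      "\<And>j i. i \<ge> n \<Longrightarrow> coeff (r j) i = 0"
    by metis
  \<comment> \<open>Row \<open>j\<close> holds the coordinates of \<open>g\<close> times the
    \<open>j\<close>-th power of x modulo \<open>f\<close>, so \<open>A\<close> represents
    multiplication by \<open>g\<close>.\<close>
  define A where "A = Matrix.mat n n (\<lambda>(j, i). coeff (r j) i)"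
  have A: "A \<in> carrier_mat n n"
    by (simp add: A_def)
  have root: "poly (char_poly A) (poly g z) = 0" if "z \<in> S" for z
  proof -
    \<comment> \<open>Evaluation at a root \<open>z\<close> kills \<open>f\<close>, so the vector of
      powers of \<open>z\<close> is an eigenvector with eigenvalue \<open>poly g z\<close>.\<close>
    let ?v = "Matrix.vec n (\<lambda>i. z ^ i)"
    have "poly (r j) z = poly g z * z ^ j" for j
      using arg_cong[OF qr(2)[of j], of "\<lambda>h. poly h z"] S(2)[OF that] by (simp add: poly_monom)
    moreover have "poly (r j) z = (\<Sum>i = 0..<n. coeff (r j) i * z ^ i)" for j
    proof -
      have "poly (r j) z = (\<Sum>i<n. coeff (r j) i * z ^ i)"
        unfolding poly_altdef using qr(3)[of _ j]
        by (intro sum.mono_neutral_cong) (auto simp: coeff_eq_0 not_less)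
      then show ?thesis
        by (simp add: atLeast0LessThan)
    qed
    ultimately have "A *\<^sub>v ?v = poly g z \<cdot>\<^sub>v ?v"
      by (intro eq_vecI) (auto simp: A_def scalar_prod_def)
    moreover have "?v \<noteq> 0\<^sub>v n"
    proof
      assume "?v = 0\<^sub>v n"
      then have "?v $ 0 = 0\<^sub>v n $ 0"
        by simp
      then show False
        using f(3) by (simp add: n_def)
    qed
    ultimately have "eigenvalue A (poly g z)"
      using A unfolding eigenvalue_def eigenvector_def by (intro exI[of _ ?v]) auto
    then show ?thesis
      using eigenvalue_root_char_poly[OF A] by simp
  qed
  \<comment> \<open>Injectivity of \<open>poly g\<close> on \<open>S\<close> supplies as many
    distinct eigenvalues as the matrix has rows, so they exhaust the characteristic
    polynomial.\<close>
  have "(\<Prod>w\<in>poly g ` S. [:- w, 1:]) = char_poly A"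
  proof (rule monic_dvd_imp_eq)
    show "(\<Prod>w\<in>poly g ` S. [:- w, 1:]) dvd char_poly A"
      using finS root by (intro prod_linear_factors_dvd) auto
    show "degree (\<Prod>w\<in>poly g ` S. [:- w, 1:]) = degree (char_poly A)"
      using degree_monic_char_poly[OF A] S(1) card_image[OF S(3)]
      by (simp add: degree_prod_linear_factors n_def)
  qed (use degree_monic_char_poly[OF A] in \<open>auto simp: monic_prod_linear_factors\<close>)
  moreover have "char_poly A \<in> polys"
    using qr(1) by (intro polys_char_poly[OF A]) (auto simp: A_def polys_iff)
  ultimately show ?thesis
    by simp
qed

end

subsection \<open>Hermite polynomials\<close>

lemma hermite_degree_monic: "degree (hermite n) = n \<and> lead_coeff (hermite n) = 1"
proof (induction n)
  case (Suc n)
  have d: "degree (hermite n) = n"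
    using Suc by blast
  then have l: "coeff (hermite n) n = 1"
    using Suc by metis
  have c: "coeff (hermite (Suc n)) i = (case i of 0 \<Rightarrow> 0 | Suc j \<Rightarrow> coeff (hermite n) j)
      - of_nat (Suc i) * coeff (hermite n) (Suc i)" for i
    by (simp add: coeff_pderiv coeff_pCons)
  have "coeff (hermite (Suc n)) (Suc n) = 1"
    using d l unfolding c by (simp add: coeff_eq_0)
  moreover from this have "degree (hermite (Suc n)) = Suc n"
    by (intro degree_eqI_coeff) (use d in \<open>auto simp: c coeff_eq_0 split: nat.splits simp del: hermite.simps\<close>)
  ultimately show ?case
    by (simp del: hermite.simps)
qed simp

lemma degree_hermite [simp]: "degree (hermite n) = n"
  using hermite_degree_monic by blast

lemma lead_coeff_hermite [simp]: "coeff (hermite n) n = 1"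
  using hermite_degree_monic[of n] by simp

lemma hermite_nonzero [simp]: "hermite n \<noteq> 0"
  using lead_coeff_hermite[of n] by (metis coeff_0 zero_neq_one)

text \<open>Differentiating the recurrence gives H_(n+1) plus the recurrence operator applied to
  H_(n+1)'; by induction the latter is n+1 times H_(n+1).\<close>

lemma pderiv_hermite_Suc: "pderiv (hermite (Suc n)) = smult (of_nat (Suc n)) (hermite n)"
proof (induction n)
  case (Suc n)
  have "pderiv (hermite (Suc (Suc n))) =
      hermite (Suc n) + ([:0, 1:] * pderiv (hermite (Suc n)) - pderiv (pderiv (hermite (Suc n))))"
    by (simp add: pderiv_diff pderiv_mult pderiv_pCons del: mult_pCons_left)
  also have "[:0, 1:] * pderiv (hermite (Suc n)) - pderiv (pderiv (hermite (Suc n))) =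
      smult (of_nat (Suc n)) (hermite (Suc n))"
    unfolding Suc by (simp add: pderiv_smult smult_diff_right)
  finally show ?case
    by (simp only: of_nat_Suc[of "Suc n"] smult_add_left smult_1_left)
qed (simp add: pderiv_pCons)

lemma poly_hermite_Suc_Suc:
  "poly (hermite (Suc (Suc n))) x = x * poly (hermite (Suc n)) x - of_nat (Suc n) * poly (hermite n) x"
  by (subst hermite.simps(2), subst pderiv_hermite_Suc) (simp del: hermite.simps)

lemma poly_hermite_minus: "poly (hermite n) (- x) = (- 1) ^ n * poly (hermite n) x"
proof (induction n rule: induct_nat_012)
  case (ge2 n)
  then show ?case
    by (simp add: poly_hermite_Suc_Suc algebra_simps del: hermite.simps)
qed simp_all

text \<open>By the three-term recurrence a common zero of two neighbours would descend to H_0 =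
  1.\<close>

lemma hermite_no_common_root: "poly (hermite (Suc n)) z = 0 \<Longrightarrow> poly (hermite n) z \<noteq> 0"
  by (induction n) (auto simp: poly_hermite_Suc_Suc simp del: hermite.simps(2))

lemma (in real_subring) hermite_mem: "hermite n \<in> polys"
  by (induction n) (auto simp: polys_1 simp del: mult_pCons_left
      intro!: polys_diff polys_mult polys_pderiv polys_pCons polys_0 zero_mem one_mem)

subsection \<open>Gaussian integration by parts\<close>

text \<open>The expectation of \<open>v\<close> at a standard normal variable, written as an
  integral so that the analysis does not refer to a probability space.\<close>

definition gauss_mean :: "(real \<Rightarrow> real) \<Rightarrow> real" where
  "gauss_mean v = (\<integral>x. std_normal_density x * v x \<partial>lborel)"

text \<open>Continuous functions of polynomial growth: closed under the operations used below,
  integrable against the Gaussian density, with vanishing boundary terms, and containing the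
  truncated powers used as test functions.\<close>

definition poly_bounded :: "(real \<Rightarrow> real) \<Rightarrow> bool" where
  "poly_bounded v \<longleftrightarrow> continuous_on UNIV v \<and> (\<exists>q. \<forall>x. \<bar>v x\<bar> \<le> poly q x)"

lemma poly_boundedI: "continuous_on UNIV v \<Longrightarrow> (\<And>x. \<bar>v x\<bar> \<le> poly q x) \<Longrightarrow> poly_bounded v"
  by (auto simp: poly_bounded_def)

lemma poly_boundedE:
  assumes "poly_bounded v"
  obtains q where "continuous_on UNIV v" "\<And>x. \<bar>v x\<bar> \<le> poly q x" "\<And>x. 0 \<le> poly q x"
  using assms unfolding poly_bounded_def by (meson abs_ge_zero order_trans)

lemma abs_le_one_plus_square: "\<bar>a\<bar> \<le> 1 + a\<^sup>2" for a :: real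
  using zero_le_power2[of "\<bar>a\<bar> - 1"] unfolding power2_diff by simp

lemma poly_bounded_poly: "poly_bounded (poly q)"
proof (rule poly_boundedI)
  show "\<bar>poly q x\<bar> \<le> poly (1 + q * q) x" for x
    using abs_le_one_plus_square[of "poly q x"] by (simp add: power2_eq_square)
qed (intro continuous_intros)

lemma poly_bounded_add: "poly_bounded v \<Longrightarrow> poly_bounded w \<Longrightarrow> poly_bounded (\<lambda>x. v x + w x)"
proof (elim poly_boundedE)
  fix a b assume "continuous_on UNIV v" "continuous_on UNIV w"
    "\<And>x. \<bar>v x\<bar> \<le> poly a x" "\<And>x. \<bar>w x\<bar> \<le> poly b x"
  then show ?thesis
    by (intro poly_boundedI[of _ "a + b"] continuous_intros)
      (auto intro: order_trans[OF abs_triangle_ineq add_mono])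
qed

lemma poly_bounded_mult: "poly_bounded v \<Longrightarrow> poly_bounded w \<Longrightarrow> poly_bounded (\<lambda>x. v x * w x)"
proof (elim poly_boundedE)
  fix a b assume "continuous_on UNIV v" "continuous_on UNIV w"
    "\<And>x. \<bar>v x\<bar> \<le> poly a x" "\<And>x. \<bar>w x\<bar> \<le> poly b x" "\<And>x. 0 \<le> poly a x"
  then show ?thesis
    by (intro poly_boundedI[of _ "a * b"] continuous_intros)
      (auto simp: abs_mult intro: mult_mono)
qed

lemma poly_bounded_const: "poly_bounded (\<lambda>x. c)"
  by (rule poly_boundedI[of _ "[:\<bar>c\<bar>:]"]) (auto intro: continuous_intros)

lemma poly_bounded_sum: "(\<And>i. i \<in> A \<Longrightarrow> poly_bounded (v i)) \<Longrightarrow> poly_bounded (\<lambda>x. \<Sum>i\<in>A. v i x)"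
  by (induction A rule: infinite_finite_induct) (auto intro: poly_bounded_add poly_bounded_const)

lemma poly_bounded_power: "poly_bounded v \<Longrightarrow> poly_bounded (\<lambda>x. v x ^ n)"
  by (induction n) (auto intro: poly_bounded_mult poly_bounded_const)

lemma poly_bounded_compose:
  assumes "poly_bounded v"
  shows "poly_bounded (\<lambda>x. v (poly q x))"
proof -
  obtain a where a: "continuous_on UNIV v" "\<And>x. \<bar>v x\<bar> \<le> poly a x"
    using assms by (metis poly_boundedE)
  have "continuous_on UNIV (\<lambda>x. v (poly q x))"
    by (rule continuous_on_compose2[OF a(1)]) (auto intro: continuous_intros)
  then show ?thesis
    using a(2) by (intro poly_boundedI[of _ "pcompose a q"]) (auto simp: poly_pcompose)
qed

lemma integrable_std_normal_poly: "integrable lborel (\<lambda>x. std_normal_density x * poly q x)"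
  unfolding poly_altdef sum_distrib_left
  by (intro Bochner_Integration.integrable_sum)
    (auto simp: mult.left_commute intro: integrable_std_normal_moment)

lemma integrable_std_normal_poly_bounded:
  assumes "poly_bounded v"
  shows "integrable lborel (\<lambda>x. std_normal_density x * v x)"
proof -
  obtain q where q: "continuous_on UNIV v" "\<And>x. \<bar>v x\<bar> \<le> poly q x" "\<And>x. 0 \<le> poly q x"
    using assms by (metis poly_boundedE)
  have [measurable]: "v \<in> borel_measurable borel"
    using q(1) by (rule borel_measurable_continuous_onI)
  show ?thesis
    by (rule Bochner_Integration.integrable_bound[OF integrable_std_normal_poly[of q]])
      (use q in \<open>auto simp: abs_mult intro!: mult_left_mono\<close>)
qed

lemma gauss_mean_add:
  "poly_bounded v \<Longrightarrow> poly_bounded w \<Longrightarrow> gauss_mean (\<lambda>x. v x + w x) = gauss_mean v + gauss_mean w"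
  by (simp add: gauss_mean_def distrib_left integrable_std_normal_poly_bounded)

lemma gauss_mean_cmult: "gauss_mean (\<lambda>x. c * v x) = c * gauss_mean v"
  by (simp add: gauss_mean_def mult.left_commute)

lemma gauss_mean_const: "gauss_mean (\<lambda>x. c) = c"
  using integral_std_normal_moment_even[of 0] gauss_mean_cmult[of c "\<lambda>x. 1"]
  by (simp add: gauss_mean_def)

lemma gauss_mean_sum:
  "(\<And>i. i \<in> A \<Longrightarrow> poly_bounded (v i)) \<Longrightarrow>
    gauss_mean (\<lambda>x. \<Sum>i\<in>A. v i x) = (\<Sum>i\<in>A. gauss_mean (v i))"
  by (induction A rule: infinite_finite_induct)
    (auto simp: gauss_mean_const gauss_mean_add poly_bounded_sum)

text \<open>The density never vanishes, so \<open>v\<close> is zero almost everywhere; by continuity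
  a nonzero value would persist on a ball, which has positive Lebesgue measure.\<close>

lemma gauss_mean_zeroD:
  assumes v: "poly_bounded v" "\<And>x. 0 \<le> v x" and zero: "gauss_mean v = 0"
  shows "v x = 0"
proof (rule ccontr)
  assume x: "v x \<noteq> 0"
  have cont: "continuous_on UNIV v"
    using v(1) by (simp add: poly_bounded_def)
  have "AE x in lborel. std_normal_density x * v x = 0"
    using zero integral_nonneg_eq_0_iff_AE[OF integrable_std_normal_poly_bounded[OF v(1)]] v(2)
    by (simp add: gauss_mean_def)
  moreover have "std_normal_density x \<noteq> 0" for x
    by (simp add: normal_density_def)
  ultimately have AE: "AE x in lborel. v x = 0"
    by simp
  have "open (v -` (- {0}))"
    using cont by (intro open_vimage) auto
  then obtain e where e: "e > 0" "ball x e \<subseteq> v -` (- {0})"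
    using x by (auto elim: openE)
  have "AE y in lborel. y \<notin> ball x e"
    using AE by eventually_elim (use e(2) in blast)
  then have "emeasure lborel (ball x e) = 0"
    by (subst (asm) AE_iff_measurable[OF _ refl]) (auto simp: ball_def)
  moreover have "ball x e = {x - e<..<x + e}"
    by (auto simp: dist_real_def)
  ultimately show False
    using e(1) by simp
qed

lemma tendsto_std_normal_power: "((\<lambda>x. std_normal_density x * x ^ k) \<longlongrightarrow> 0) at_top"
  unfolding normal_density_def by simp real_asymp

lemma tendsto_std_normal_poly: "((\<lambda>x. std_normal_density x * poly q x) \<longlongrightarrow> 0) at_top"
proof -
  have "((\<lambda>x. \<Sum>i\<le>degree q. coeff q i * (std_normal_density x * x ^ i)) \<longlongrightarrow> 0) at_top"
    by (intro tendsto_null_sum tendsto_mult_right_zero tendsto_std_normal_power)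
  then show ?thesis
    by (simp add: poly_altdef sum_distrib_left mult.left_commute)
qed

lemma tendsto_std_normal_poly_bounded:
  assumes "poly_bounded v"
  shows "((\<lambda>x. std_normal_density x * v x) \<longlongrightarrow> 0) at_top"
    and "((\<lambda>x. std_normal_density x * v x) \<longlongrightarrow> 0) at_bot"
proof -
  have *: "((\<lambda>x. std_normal_density x * w x) \<longlongrightarrow> 0) at_top" if "poly_bounded w" for w
  proof -
    obtain q where q: "\<And>x. \<bar>w x\<bar> \<le> poly q x" "\<And>x. 0 \<le> poly q x"
      using \<open>poly_bounded w\<close> by (metis poly_boundedE)
    show ?thesis
      by (rule Lim_null_comparison[OF _ tendsto_std_normal_poly[of q]])
        (use q in \<open>auto simp: abs_mult intro!: always_eventually mult_left_mono\<close>)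
  qed
  from *[OF assms] show "((\<lambda>x. std_normal_density x * v x) \<longlongrightarrow> 0) at_top" .
  have "poly_bounded (\<lambda>x. v (- x))"
    using poly_bounded_compose[OF assms, of "[:0, -1:]"] by simp
  from *[OF this] show "((\<lambda>x. std_normal_density x * v x) \<longlongrightarrow> 0) at_bot"
    by (simp add: filterlim_at_bot_mirror normal_density_def)
qed

lemma DERIV_std_normal_density:
  "(std_normal_density has_real_derivative - x * std_normal_density x) (at x)"
  unfolding normal_density_def by (auto intro!: derivative_eq_intros simp: field_simps)

text \<open>The map taking \<open>h\<close> to x h - h' is adjoint to differentiation under the
  Gaussian weight: the derivative of density times h u is density times (h u' - (x h - h') u), and
  the boundary terms vanish.\<close>

lemma gauss_mean_by_parts:
  assumes u: "poly_bounded u" "poly_bounded u'"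
    and deriv: "\<And>x. (u has_real_derivative u' x) (at x)"
  shows "gauss_mean (\<lambda>x. poly ([:0, 1:] * h - pderiv h) x * u x) = gauss_mean (\<lambda>x. poly h x * u' x)"
proof -
  define g where "g = [:0, 1:] * h - pderiv h"
  define w where "w = (\<lambda>x. poly h x * u' x + poly (- g) x * u x)"
  let ?F = "\<lambda>x. std_normal_density x * (poly h x * u x)"
  have w: "poly_bounded w"
    unfolding w_def by (intro poly_bounded_add poly_bounded_mult poly_bounded_poly u)
  have hu: "poly_bounded (\<lambda>x. poly h x * u x)"
    by (intro poly_bounded_mult poly_bounded_poly u)
  have "(LBINT x=-\<infinity>..\<infinity>. std_normal_density x * w x) = 0 - 0"
  proof (rule interval_integral_FTC_integrable)
    show "(?F has_vector_derivative std_normal_density x * w x) (at x)" for x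
      unfolding has_real_derivative_iff_has_vector_derivative[symmetric] w_def g_def
      by (auto intro!: derivative_eq_intros DERIV_std_normal_density deriv simp: algebra_simps)
    have "continuous_on UNIV (\<lambda>x. std_normal_density x * w x)"
      using w unfolding poly_bounded_def normal_density_def by (intro continuous_intros) auto
    then show "isCont (\<lambda>x. std_normal_density x * w x) x" for x
      by (simp add: continuous_on_eq_continuous_at)
    show "set_integrable lborel (einterval (-\<infinity>) \<infinity>) (\<lambda>x. std_normal_density x * w x)"
      using integrable_std_normal_poly_bounded[OF w] by (simp add: set_integrable_def einterval_def)
    show "((?F \<circ> real_of_ereal) \<longlongrightarrow> 0) (at_right (-\<infinity>))"
      using tendsto_std_normal_poly_bounded(2)[OF hu] by (simp add: ereal_tendsto_simps)
    show "((?F \<circ> real_of_ereal) \<longlongrightarrow> 0) (at_left \<infinity>)"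
      using tendsto_std_normal_poly_bounded(1)[OF hu] by (simp add: ereal_tendsto_simps)
  qed simp
  then have "gauss_mean w = 0"
    by (simp add: gauss_mean_def interval_lebesgue_integral_def set_lebesgue_integral_def einterval_def)
  moreover have "gauss_mean w = gauss_mean (\<lambda>x. poly h x * u' x) + gauss_mean (\<lambda>x. - 1 * (poly g x * u x))"
    unfolding w_def by (subst gauss_mean_add)
      (auto intro!: poly_bounded_mult poly_bounded_poly u simp del: poly_minus, simp)
  ultimately show ?thesis
    unfolding gauss_mean_cmult by (simp add: g_def)
qed

subsection \<open>Zeros and critical values of the Hermite polynomials\<close>

text \<open>Each integration by parts lowers both the Hermite index and the degree of
  \<open>q\<close>.\<close>

lemma hermite_orthogonal: "degree q < n \<Longrightarrow> gauss_mean (\<lambda>x. poly (hermite n) x * poly q x) = 0"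
proof (induction n arbitrary: q)
  case (Suc n)
  have "gauss_mean (\<lambda>x. poly (hermite (Suc n)) x * poly q x) =
      gauss_mean (\<lambda>x. poly (hermite n) x * poly (pderiv q) x)"
    unfolding hermite.simps by (intro gauss_mean_by_parts poly_bounded_poly poly_DERIV)
  also have "\<dots> = 0"
  \<comment> \<open>A constant \<open>q\<close> is separate because its derivative keeps degree 0,
    which is not below the index when \<open>n = 0\<close>.\<close>
  proof (cases "degree q = 0")
    case True
    then show ?thesis
      by (simp add: pderiv_eq_0_iff[THEN iffD2] gauss_mean_const)
  next
    case False
    then show ?thesis
      using Suc by (simp add: degree_pderiv)
  qed
  finally show ?case .
qed simp

lemma poly_no_roots_constant_sign:
  fixes r :: "real poly"
  assumes "\<And>x. poly r x \<noteq> 0"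
  obtains "\<And>x. poly r x > 0" | "\<And>x. poly r x < 0"
  using assms poly_IVT_neg[of _ _ r] poly_IVT_pos[of _ _ r] by (metis linorder_cases)

text \<open>Write H_n = q r with \<open>q\<close> the product over the distinct real zeros. Then
  \<open>r\<close> has no real zero, so H_n q = r q^2 has constant sign; if \<open>q\<close> had
  degree below \<open>n\<close>, orthogonality would force \<open>q = 0\<close>.\<close>

lemma hermite_zeros_card: "card {z. poly (hermite n) z = 0} = n"
proof -
  define S where "S = {z. poly (hermite n) z = 0}"
  define q where "q = (\<Prod>z\<in>S. [:- z, 1:])"
  have fin: "finite S"
    unfolding S_def by (intro poly_roots_finite) simp
  have "q dvd hermite n"
    unfolding q_def using fin by (intro prod_linear_factors_dvd) (auto simp: S_def)
  then obtain r where r: "hermite n = q * r"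
    by auto
  have "r \<noteq> 0" "q \<noteq> 0"
    using r hermite_nonzero[of n] by auto
  then have deg: "card S + degree r = n"
    using arg_cong[OF r, of degree] by (simp add: degree_mult_eq q_def degree_prod_linear_factors)
  \<comment> \<open>A zero of \<open>r\<close> would be a multiple zero of H_n, hence also a zero of
    H_(n-1), since H_n' = n H_(n-1).\<close>
  have r_nz: "poly r z \<noteq> 0" for z
  proof
    assume z: "poly r z = 0"
    then have "z \<in> S"
      by (simp add: S_def r)
    then have q: "poly q z = 0"
      unfolding q_def using fin by (subst poly_prod_linear_factors) auto
    then obtain m where n: "n = Suc m"
      using arg_cong[OF r, of "\<lambda>h. poly h z"] by (cases n) auto
    have "poly (pderiv (hermite n)) z = 0"
      using q z by (simp add: r pderiv_mult)
    then have "poly (hermite m) z = 0"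
      unfolding n pderiv_hermite_Suc by simp
    moreover have "poly (hermite (Suc m)) z = 0"
      using n \<open>z \<in> S\<close> by (simp add: S_def)
    ultimately show False
      using hermite_no_common_root by blast
  qed
  obtain s :: real where s: "\<And>x. s * poly r x > 0"
    by (rule poly_no_roots_constant_sign[OF r_nz]) (use that[of 1] that[of "-1"] in auto)
  have "\<not> card S < n"
  proof
    assume "card S < n"
    then have "gauss_mean (\<lambda>x. poly (hermite n) x * poly q x) = 0"
      by (intro hermite_orthogonal) (simp add: q_def degree_prod_linear_factors)
    then have "gauss_mean (\<lambda>x. s * (poly (hermite n) x * poly q x)) = 0"
      by (simp add: gauss_mean_cmult)
    moreover have eq: "s * (poly (hermite n) x * poly q x) = (s * poly r x) * (poly q x)\<^sup>2" for x
      by (simp add: r power2_eq_square)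
    ultimately have *: "gauss_mean (\<lambda>x. (s * poly r x) * (poly q x)\<^sup>2) = 0"
      by simp
    have "(s * poly r x) * (poly q x)\<^sup>2 = 0" for x
      by (rule gauss_mean_zeroD[OF _ _ *])
        (use s in \<open>auto intro!: poly_bounded_mult poly_bounded_const poly_bounded_poly poly_bounded_power
            mult_nonneg_nonneg less_imp_le simp: less_imp_le\<close>)
    then have "poly q x = 0" for x
      using s[of x] by (metis mult_eq_0_iff less_irrefl zero_eq_power2)
    then show False
      using \<open>q \<noteq> 0\<close> poly_all_0_iff_0 by blast
  qed
  then show ?thesis
    using deg by (simp add: S_def)
qed

section \<open>Critical points and distinctness of critical values\<close>

lemma pderiv_hermite_zeros:
  "{z. poly (pderiv (hermite (Suc n))) z = 0} = {z. poly (hermite n) z = 0}"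
  unfolding pderiv_hermite_Suc by auto

lemma hermite_zeros_finite: "finite {z. poly (hermite n) z = 0}"
  by (intro poly_roots_finite) simp

lemma hermite_zeros_minus: "poly (hermite n) z = 0 \<Longrightarrow> poly (hermite n) (- z) = 0"
  by (simp add: poly_hermite_minus)

text \<open>
  Sonin's argument: the auxiliary function \<open>H\<^sub>n\<^sub>+\<^sub>1\<^sup>2 + (n + 1) H\<^sub>n\<^sup>2\<close> has the derivative
  \<open>2 (n + 1) x H\<^sub>n\<^sup>2\<close> and agrees with \<open>H\<^sub>n\<^sub>+\<^sub>1\<^sup>2\<close> at the zeros of \<open>H\<^sub>n\<close>.
\<close>

lemma hermite_critical_values_less:
  assumes a: "poly (hermite n) a = 0" "0 \<le> a" and b: "poly (hermite n) b = 0" "a < b"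
  shows "(poly (hermite (Suc n)) a)\<^sup>2 < (poly (hermite (Suc n)) b)\<^sup>2"
proof -
  define c :: real where "c = of_nat (Suc n)"
  define F where "F = hermite (Suc n) * hermite (Suc n) + smult c (hermite n * hermite n)"
  have F': "pderiv F = smult (2 * c) ([:0, 1:] * (hermite n * hermite n))"
  proof -
    have "pderiv F = smult (2 * c) (hermite n * (hermite (Suc n) + pderiv (hermite n)))"
      unfolding F_def pderiv_add pderiv_mult pderiv_smult pderiv_hermite_Suc c_def[symmetric]
      by (rule poly_ext) (simp add: algebra_simps del: hermite.simps)
    then show ?thesis
      by (simp add: algebra_simps del: mult_pCons_left mult_pCons_right)
  qed
  have mono: "poly F x \<le> poly F y" if "0 \<le> x" "x \<le> y" for x y
  proof (rule DERIV_nonneg_imp_nondecreasing[OF that(2)])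
    fix z assume "x \<le> z" "z \<le> y"
    then show "\<exists>d. (poly F has_real_derivative d) (at z) \<and> 0 \<le> d"
      using that(1) by (intro exI[of _ "poly (pderiv F) z"] conjI poly_DERIV) (simp add: F' c_def)
  qed
  \<comment> \<open>Strictness: equal values would make the monotone polynomial \<open>F\<close>
    constant on an interval and hence everywhere, but its derivative is nonzero.\<close>
  have "poly F a \<noteq> poly F b"
  proof
    assume eq: "poly F a = poly F b"
    have "poly (F - [:poly F a:]) x = 0" if "x \<in> {a..b}" for x
      using mono[of a x] mono[of x b] a b eq that by simp
    then have "{a..b} \<subseteq> {x. poly (F - [:poly F a:]) x = 0}"
      by blast
    moreover have "infinite {a..b}"
      using b by simp
    ultimately have "F - [:poly F a:] = 0"
      using poly_roots_finite infinite_super by blast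
    then have "pderiv F = pderiv [:poly F a:]"
      by simp
    then have "pderiv F = 0"
      by (simp add: pderiv_pCons)
    then show False
      by (simp add: F' c_def del: mult_pCons_left)
  qed
  then have "poly F a < poly F b"
    using mono[of a b] a b by simp
  then show ?thesis
    using a b by (simp add: F_def power2_eq_square del: hermite.simps)
qed

lemma hermite_critical_values_inj_nonneg:
  "inj_on (\<lambda>z. (poly (hermite (Suc n)) z)\<^sup>2) {z. poly (hermite n) z = 0 \<and> 0 \<le> z}"
proof (rule linorder_inj_onI')
  fix a b
  assume "a \<in> {z. poly (hermite n) z = 0 \<and> 0 \<le> z}" "b \<in> {z. poly (hermite n) z = 0 \<and> 0 \<le> z}" "a < b"
  then show "(poly (hermite (Suc n)) a)\<^sup>2 \<noteq> (poly (hermite (Suc n)) b)\<^sup>2"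
    using hermite_critical_values_less[of n a b] by simp
qed

text \<open>Equal critical values have equal squares, which determine the absolute value of the
  zero. Opposite zeros are told apart because H_(n+1) is odd and does not vanish at zeros of
  H_n.\<close>

lemma hermite_critical_values_inj:
  assumes "even n"
  shows "inj_on (poly (hermite (Suc n))) {z. poly (hermite n) z = 0}"
proof (rule inj_onI)
  fix a b
  assume ab: "a \<in> {z. poly (hermite n) z = 0}" "b \<in> {z. poly (hermite n) z = 0}"
    and eq: "poly (hermite (Suc n)) a = poly (hermite (Suc n)) b"
  have sq: "(poly (hermite (Suc n)) \<bar>z\<bar>)\<^sup>2 = (poly (hermite (Suc n)) z)\<^sup>2" for z
    using assms by (cases "z \<ge> 0") (simp_all add: poly_hermite_minus del: hermite.simps)
  have "poly (hermite n) \<bar>z\<bar> = 0" if "poly (hermite n) z = 0" for z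
    using that by (cases "z \<ge> 0") (simp_all add: hermite_zeros_minus)
  then have "\<bar>a\<bar> = \<bar>b\<bar>"
    using inj_onD[OF hermite_critical_values_inj_nonneg[of n], of "\<bar>a\<bar>" "\<bar>b\<bar>"] ab eq
    by (simp add: sq del: hermite.simps)
  moreover have "poly (hermite (Suc n)) (- b) \<noteq> poly (hermite (Suc n)) b"
    using hermite_no_common_root[of n b] ab assms
    by (auto simp: poly_hermite_minus[of "Suc n"] simp del: hermite.simps)
  ultimately show "a = b"
    using eq by (metis abs_eq_iff)
qed

text \<open>In an even polynomial the linear coefficient vanishes, and what remains after removing
  the two lowest coefficients is again even.\<close>

lemma even_poly_pcompose_square:
  fixes f :: "real poly"
  assumes "pcompose f [:0, -1:] = f"
  obtains g where "f = pcompose g [:0, 0, 1:]"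
proof -
  have "\<exists>g. f = pcompose g [:0, 0, 1:]" using assms
  proof (induction "degree f" arbitrary: f rule: less_induct)
    case less
    show ?case
    proof (cases "degree f = 0")
      case True
      then show ?thesis
        by (metis degree_eq_zeroE pcompose_const)
    next
      case False
      obtain a b h where f: "f = pCons a (pCons b h)"
        by (metis pCons_cases)
      have "h \<noteq> 0 \<or> b \<noteq> 0"
        using False f by auto
      have "pcompose f [:0, -1:] = pCons a (pCons (- b) (pcompose h [:0, -1:]))"
        by (simp add: f pcompose_pCons)
      then have b: "b = 0" and h: "pcompose h [:0, -1:] = h"
        using less.prems by (auto simp: f)
      then have "degree h < degree f"
        using \<open>h \<noteq> 0 \<or> b \<noteq> 0\<close> by (simp add: f)
      then obtain g where "h = pcompose g [:0, 0, 1:]"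
        using less.hyps h by blast
      then have "f = pcompose (pCons a g) [:0, 0, 1:]"
        by (simp add: f b pcompose_pCons)
      then show ?thesis ..
    qed
  qed
  then show ?thesis
    using that by blast
qed

text \<open>The zeros are symmetric about 0 and include 0, while H_(n+1) is even, so negative zeros
  contribute no new critical values.\<close>

lemma hermite_zeros_odd:
  assumes "odd n"
  defines "Z \<equiv> {z. poly (hermite n) z = 0 \<and> 0 \<le> z}"
  shows "2 * card Z = Suc n"
    and "poly (hermite (Suc n)) ` {z. poly (hermite n) z = 0} = poly (hermite (Suc n)) ` Z"
proof -
  have fin: "finite Z"
    unfolding Z_def by (rule finite_subset[OF _ hermite_zeros_finite[of n]]) auto
  have zero: "0 \<in> Z"
    using poly_hermite_minus[of n 0] assms(1) by (simp add: Z_def)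
  have split: "{z. poly (hermite n) z = 0} = Z \<union> uminus ` (Z - {0})"
    (is "?L = ?R")
  proof
    show "?L \<subseteq> ?R"
    proof
      fix z assume "z \<in> ?L"
      then have "z \<in> Z \<or> - z \<in> Z - {0}"
        using hermite_zeros_minus[of n z] by (auto simp: Z_def)
      then show "z \<in> ?R"
        by (metis UnI1 UnI2 image_eqI minus_minus)
    qed
  qed (auto simp: Z_def hermite_zeros_minus)
  have "card (Z \<union> uminus ` (Z - {0})) = card Z + card (Z - {0})"
    using fin by (subst card_Un_disjoint) (auto simp: Z_def card_image)
  then have "n = card Z + (card Z - 1)"
    using hermite_zeros_card[of n] split fin zero by simp
  moreover have "card Z > 0"
    using fin zero card_gt_0_iff by blast
  ultimately show "2 * card Z = Suc n"
    by simp
  have "poly (hermite (Suc n)) ` uminus ` (Z - {0}) \<subseteq> poly (hermite (Suc n)) ` Z"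
    using assms(1) by (auto simp: poly_hermite_minus simp del: hermite.simps)
  then show "poly (hermite (Suc n)) ` {z. poly (hermite n) z = 0} = poly (hermite (Suc n)) ` Z"
    unfolding split image_Un by blast
qed

lemma critical_poly_Suc:
  "critical_poly (Suc n) = (\<Prod>w \<in> poly (hermite (Suc n)) ` {z. poly (hermite n) z = 0}. [:- w, 1:])"
  unfolding critical_poly_def pderiv_hermite_zeros ..

lemma degree_critical_poly:
  "degree (critical_poly (Suc n)) = (if even n then n else Suc n div 2)"
proof (cases "even n")
  case True
  then show ?thesis
    unfolding critical_poly_Suc degree_prod_linear_factors
    by (simp add: card_image hermite_critical_values_inj hermite_zeros_card del: hermite.simps)
next
  case False
  have "inj_on (poly (hermite (Suc n))) {z. poly (hermite n) z = 0 \<and> 0 \<le> z}"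
    by (rule inj_onI, rule inj_onD[OF hermite_critical_values_inj_nonneg[of n]]) simp_all
  then show ?thesis
    unfolding critical_poly_Suc degree_prod_linear_factors hermite_zeros_odd(2)[OF False]
    using False hermite_zeros_odd(1)[OF False] by (simp add: card_image del: hermite.simps)
qed

subsection \<open>The critical ideal\<close>

context real_subring
begin

lemma critical_poly_mem: "critical_poly (Suc n) \<in> polys"
proof (cases "even n")
  case True
  show ?thesis
  \<comment> \<open>For \<open>n = 0\<close> the product is empty; the root-value lemma needs a
    divisor of positive degree.\<close>
  proof (cases "n = 0")
    case True
    then show ?thesis
      by (simp add: critical_poly_Suc polys_1)
  next
    case False
    then show ?thesis
      unfolding critical_poly_Suc using True
      by (intro polys_prod_root_values[of "hermite n"])
        (auto simp: hermite_mem hermite_zeros_card hermite_critical_values_inj simp del: hermite.simps)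
  qed
next
  case False
  let ?H = "hermite (Suc n)" and ?q = "[:0, 0, 1:] :: real poly"
  define Z where "Z = {z. poly (hermite n) z = 0 \<and> 0 \<le> z}"
  have q: "?q \<in> polys" "lead_coeff ?q = 1" "degree ?q > 0"
    by (auto intro!: polys_pCons polys_0 zero_mem one_mem)
  have "pcompose ?H [:0, -1:] = ?H"
    by (rule poly_ext) (use False in \<open>simp add: poly_pcompose poly_hermite_minus del: hermite.simps\<close>)
  then obtain G where G: "?H = pcompose G ?q"
    by (rule even_poly_pcompose_square)
  \<comment> \<open>H_n is odd here, and the factor x makes it even. The resulting double zero at 0
    becomes a simple root of \<open>E\<close>, so the degree of \<open>E\<close> equals the number
    of nonnegative zeros.\<close>
  have "pcompose ([:0, 1:] * hermite n) [:0, -1:] = [:0, 1:] * hermite n"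
    by (rule poly_ext) (use False in \<open>simp add: poly_pcompose poly_hermite_minus del: hermite.simps\<close>)
  then obtain E where E: "[:0, 1:] * hermite n = pcompose E ?q"
    by (rule even_poly_pcompose_square)
  have degE: "2 * degree E = Suc n"
    using arg_cong[OF E, of degree] by (simp add: degree_mult_eq degree_pcompose del: mult_pCons_left)
  have "lead_coeff (pcompose E ?q) = lead_coeff E"
    by (subst lead_coeff_comp) auto
  then have lcE: "lead_coeff E = 1"
    unfolding E[symmetric] lead_coeff_mult by simp
  have E_mem: "E \<in> polys"
    by (rule polys_pcompose_monicD[OF q], fold E)
      (intro polys_mult hermite_mem polys_pCons polys_0 zero_mem one_mem)
  have G_mem: "G \<in> polys"
    by (rule polys_pcompose_monicD[OF q], fold G) (rule hermite_mem)
  have G_sq: "poly G (z\<^sup>2) = poly ?H z" for z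
    using arg_cong[OF G, of "\<lambda>h. poly h z"]
    by (simp add: poly_pcompose power2_eq_square del: hermite.simps)
  have E_sq: "poly E (z\<^sup>2) = z * poly (hermite n) z" for z
    using arg_cong[OF E, of "\<lambda>h. poly h z"] by (simp add: poly_pcompose power2_eq_square)
  have "poly ?H ` {z. poly (hermite n) z = 0} = poly G ` power2 ` Z"
    unfolding hermite_zeros_odd(2)[OF False] Z_def image_image G_sq ..
  moreover have "(\<Prod>w\<in>poly G ` power2 ` Z. [:- w, 1:]) \<in> polys"
  proof (rule polys_prod_root_values[OF E_mem lcE _ G_mem])
    show "degree E > 0"
      using degE by simp
    have "inj_on power2 Z"
      by (auto simp: inj_on_def Z_def)
    then show "card (power2 ` Z) = degree E"
      using degE hermite_zeros_odd(1)[OF False] by (simp add: card_image Z_def)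
    show "poly E y = 0" if "y \<in> power2 ` Z" for y
      using that by (auto simp: E_sq Z_def)
    have "inj_on (poly ?H) Z"
      unfolding Z_def
      by (rule inj_onI, rule inj_onD[OF hermite_critical_values_inj_nonneg[of n]]) simp_all
    then show "inj_on (poly G) (power2 ` Z)"
      by (intro inj_on_imageI) (simp only: comp_def G_sq)
  qed
  ultimately show ?thesis
    by (simp add: critical_poly_Suc del: hermite.simps)
qed

text \<open>
  Dividing by \<open>p\<close> first: if \<open>q(H\<^sub>p) = p H\<^sub>p\<^sub>-\<^sub>1 r\<close>, then \<open>q / p\<close> still has coefficients in \<open>K\<close>
  because \<open>H\<^sub>p\<close> is monic.
\<close>

lemma critical_ideal_eq:
  "critical_ideal K (Suc n) = {smult (of_nat (Suc n)) (critical_poly (Suc n) * s) | s. s \<in> polys}"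
proof -
  let ?H = "hermite (Suc n)" and ?c = "of_nat (Suc n) :: real"
  define t where "t = critical_poly (Suc n)"
  define Z where "Z = {z. poly (hermite n) z = 0}"
  have finZ: "finite Z"
    unfolding Z_def by (rule hermite_zeros_finite)
  have t: "t \<in> polys" "lead_coeff t = 1"
    using critical_poly_mem by (auto simp: t_def critical_poly_Suc monic_prod_linear_factors)
  have H: "?H \<in> polys" "lead_coeff ?H = 1" "degree ?H > 0"
    by (simp_all only: hermite_mem degree_hermite lead_coeff_hermite zero_less_Suc)
  have gen: "Idl\<^bsub>poly_ring K\<^esub> {pderiv ?H} = {pderiv ?H * r | r. r \<in> polys}"
    by (rule genideal_poly_ring[OF polys_pderiv[OF H(1)]])
  have Hn: "(\<Prod>z\<in>Z. [:- z, 1:]) = hermite n"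
  proof (rule monic_dvd_imp_eq)
    show "(\<Prod>z\<in>Z. [:- z, 1:]) dvd hermite n"
      by (rule prod_linear_factors_dvd[OF finZ]) (simp add: Z_def)
    show "degree (\<Prod>z\<in>Z. [:- z, 1:]) = degree (hermite n)"
      by (simp only: Z_def degree_prod_linear_factors hermite_zeros_card degree_hermite)
  qed (simp_all only: monic_prod_linear_factors degree_hermite lead_coeff_hermite)
  show ?thesis
  proof (intro equalityI subsetI)
    fix q assume "q \<in> critical_ideal K (Suc n)"
    then obtain r where q: "q \<in> polys" and r: "r \<in> polys" "pcompose q ?H = pderiv ?H * r"
      unfolding critical_ideal_def gen by blast
    define q' where "q' = smult (1 / ?c) q"
    have q_eq: "q = smult ?c q'"
      by (simp add: q'_def)
    have q'H: "pcompose q' ?H = hermite n * r"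
      unfolding q'_def pcompose_smult r(2) pderiv_hermite_Suc by simp
    have q'_mem: "q' \<in> polys"
      by (rule polys_pcompose_monicD[OF H]) (simp only: q'H polys_mult[OF hermite_mem r(1)])
    have "t dvd q'"
      unfolding t_def critical_poly_Suc
    proof (rule prod_linear_factors_dvd)
      show "finite (poly ?H ` {z. poly (hermite n) z = 0})"
        using finZ by (simp add: Z_def)
      fix w assume "w \<in> poly ?H ` {z. poly (hermite n) z = 0}"
      then obtain z where "w = poly ?H z" "poly (hermite n) z = 0"
        by blast
      then show "poly q' w = 0"
        using arg_cong[OF q'H, of "\<lambda>h. poly h z"] by (simp add: poly_pcompose del: hermite.simps)
    qed
    then obtain s where s: "q' = t * s"
      by auto
    then have "s \<in> polys"
      using polys_divide_monic[OF t] q'_mem by simp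
    then show "q \<in> {smult ?c (critical_poly (Suc n) * s) | s. s \<in> polys}"
      unfolding t_def[symmetric] q_eq s by blast
  next
    fix q assume "q \<in> {smult ?c (critical_poly (Suc n) * s) | s. s \<in> polys}"
    then obtain s where s: "s \<in> polys" "q = smult ?c (t * s)"
      unfolding t_def by blast
    \<comment> \<open>H_n splits into distinct linear factors, so it suffices that \<open>t\<close>
      vanishes at each critical value.\<close>
    have "hermite n dvd pcompose t ?H"
      unfolding Hn[symmetric] using finZ
    proof (rule prod_linear_factors_dvd)
      fix z assume "z \<in> Z"
      then show "poly (pcompose t ?H) z = 0"
        using finZ unfolding t_def critical_poly_Suc poly_pcompose
        by (subst poly_prod_linear_factors) (auto simp: Z_def)
    qed
    then obtain r where r: "pcompose t ?H = hermite n * r"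
      by auto
    have "r \<in> polys"
    proof (rule polys_divide_monic[OF hermite_mem])
      show "lead_coeff (hermite n) = 1"
        by simp
      show "hermite n * r \<in> polys"
        unfolding r[symmetric] by (rule polys_pcompose[OF t(1) H(1)])
    qed
    then have "r * pcompose s ?H \<in> polys"
      using s H by (intro polys_mult polys_pcompose)
    moreover have "pcompose q ?H = pderiv ?H * (r * pcompose s ?H)"
      unfolding s(2) pcompose_smult pcompose_mult r pderiv_hermite_Suc
      by (simp only: mult_smult_left mult.assoc)
    moreover have "q \<in> polys"
      unfolding s(2) using s t by (intro polys_smult polys_mult of_nat_mem)
    ultimately show "q \<in> critical_ideal K (Suc n)"
      unfolding critical_ideal_def gen by blast
  qed
qed

lemma critical_ideal_genideal:
  "critical_ideal K (Suc n) = Idl\<^bsub>poly_ring K\<^esub> {smult (of_nat (Suc n)) (critical_poly (Suc n))}"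
  unfolding critical_ideal_eq genideal_poly_ring[OF polys_smult[OF of_nat_mem critical_poly_mem]]
    mult_smult_left ..

lemma ideal_critical_ideal: "ideal (critical_ideal K (Suc n)) (poly_ring K)"
proof -
  interpret cring "poly_ring K"
    by (rule cring_poly_ring)
  show ?thesis
    unfolding critical_ideal_genideal
    by (intro genideal_ideal) (use polys_smult[OF of_nat_mem critical_poly_mem] in blast)
qed

text \<open>Here \<open>Suc n\<close> is a unit of \<open>K\<close>, so the scalar factor of the
  generator can be moved into the cofactor.\<close>

lemma critical_ideal_genideal_inverse:
  assumes "1 / of_nat (Suc n) \<in> K"
  shows "critical_ideal K (Suc n) = Idl\<^bsub>poly_ring K\<^esub> {critical_poly (Suc n)}"
proof -
  define c :: real where "c = of_nat (Suc n)"
  have c: "c \<noteq> 0" "c \<in> K" "1 / c \<in> K"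
    using assms of_nat_mem by (auto simp: c_def simp del: of_nat_Suc)
  show ?thesis
    unfolding critical_ideal_eq genideal_poly_ring[OF critical_poly_mem] c_def[symmetric]
  proof (intro equalityI subsetI)
    fix q assume "q \<in> {smult c (critical_poly (Suc n) * s) | s. s \<in> polys}"
    then obtain s where s: "q = smult c (critical_poly (Suc n) * s)" "s \<in> polys"
      by blast
    then have "q = critical_poly (Suc n) * smult c s"
      by simp
    then show "q \<in> {critical_poly (Suc n) * s | s. s \<in> polys}"
      using polys_smult[OF c(2) s(2)] by blast
  next
    fix q assume "q \<in> {critical_poly (Suc n) * s | s. s \<in> polys}"
    then obtain s where s: "q = critical_poly (Suc n) * s" "s \<in> polys"
      by blast
    then have "q = smult c (critical_poly (Suc n) * smult (1 / c) s)"
      using c(1) by simp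
    then show "q \<in> {smult c (critical_poly (Suc n) * s) | s. s \<in> polys}"
      using polys_smult[OF c(3) s(2)] by blast
  qed
qed

end

subsection \<open>Stein operators\<close>

text \<open>A test function on the whole line, listed with its successive derivatives; explicit
  derivatives avoid computing \<open>higher_deriv_on\<close> for each example.\<close>

definition deriv_chain :: "nat \<Rightarrow> (nat \<Rightarrow> real \<Rightarrow> real) \<Rightarrow> bool" where
  "deriv_chain T f \<longleftrightarrow> (\<forall>t<T. \<forall>y. (f t has_real_derivative f (Suc t) y) (at y)) \<and>
     (\<forall>t\<le>T. poly_bounded (f t))"

text \<open>The map taking \<open>h\<close> to x h - h' sends a monomial to one of the next degree
  with the same leading coefficient, so everything but a constant is removed without division. It
  sends H_k to H_(k+1), so \<open>h\<close> is the image of \<open>g\<close> under the inverse shift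
  of Hermite indices.\<close>

lemma (in real_subring) stein_decomposition:
  assumes "g \<in> polys"
  obtains m h where "h \<in> polys" "g = [:m:] + ([:0, 1:] * h - pderiv h)"
proof -
  have "\<forall>g\<in>polys. (\<forall>i\<ge>n. coeff g i = 0) \<longrightarrow>
      (\<exists>m. \<exists>h\<in>polys. g = [:m:] + ([:0, 1:] * h - pderiv h))" for n
  proof (induction n)
    case 0
    have "g = 0" if "\<forall>i\<ge>0. coeff g i = 0" for g :: "real poly"
      using that by (simp add: poly_eq_iff)
    moreover have "(0 :: real poly) = [:0:] + ([:0, 1:] * 0 - pderiv 0)"
      by simp
    ultimately show ?case
      using polys_0 by metis
  next
    case (Suc n)
    show ?case
    proof (intro ballI impI)
      fix g assume g: "g \<in> polys" "\<forall>i\<ge>Suc n. coeff g i = 0"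
      show "\<exists>m. \<exists>h\<in>polys. g = [:m:] + ([:0, 1:] * h - pderiv h)"
      proof (cases n)
        case 0
        then have "g = [:coeff g 0:] + ([:0, 1:] * 0 - pderiv 0)"
          using g(2) by (auto simp: poly_eq_iff coeff_pCons split: nat.split)
        then show ?thesis
          using polys_0 by blast
      next
        case (Suc k)
        define h where "h = monom (coeff g n) k"
        have h: "h \<in> polys"
          unfolding h_def using g(1) by (intro polys_monom) (simp add: polys_iff)
        define g' where "g' = g - ([:0, 1:] * h - pderiv h)"
        have "g' \<in> polys"
          unfolding g'_def using g(1) h
          by (intro polys_diff polys_mult polys_pderiv polys_pCons polys_0 zero_mem one_mem)
        moreover have "coeff g' i = 0" if "i \<ge> n" for i
          using that g(2) Suc
          by (cases "i = n")
            (auto simp: g'_def h_def coeff_pderiv coeff_pCons split: nat.split)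
        ultimately obtain m h' where h': "h' \<in> polys" "g' = [:m:] + ([:0, 1:] * h' - pderiv h')"
          using Suc.IH by blast
        have "g = g' + ([:0, 1:] * h - pderiv h)"
          by (simp only: g'_def diff_add_cancel)
        also have "\<dots> = [:m:] + ([:0, 1:] * (h' + h) - pderiv (h' + h))"
          unfolding h'(2) pderiv_add distrib_left by (simp only: algebra_simps)
        finally show ?thesis
          using polys_add[OF h'(1) h] by blast
      qed
    qed
  qed
  from this[of "Suc (degree g)"] assms that show ?thesis
    by (auto simp: coeff_eq_0)
qed

lemma stein_operator_inj:
  fixes h :: "real poly"
  assumes "[:0, 1:] * h - pderiv h = 0"
  shows "h = 0"
proof (rule ccontr)
  assume "h \<noteq> 0"
  then have "degree ([:0, 1:] * h) = Suc (degree h)"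
    by (simp add: degree_mult_eq del: mult_pCons_left)
  moreover have "[:0, 1:] * h = pderiv h"
    using assms by (simp only: right_minus_eq)
  ultimately have "degree (pderiv h) = Suc (degree h)"
    by (simp only:)
  then show False
    by (simp add: degree_pderiv)
qed

text \<open>Reflection turns the decomposition into one with cofactor -h(-x), and injectivity forces
  it to be \<open>h\<close>. This keeps \<open>G\<close> even throughout the recursion when
  \<open>H\<close> is even.\<close>

lemma stein_decomposition_parity:
  fixes g h :: "real poly"
  assumes g: "pcompose g [:0, -1:] = g" and h: "g = [:m:] + ([:0, 1:] * h - pderiv h)"
  shows "pcompose h [:0, -1:] = - h"
proof -
  let ?r = "[:0, -1:] :: real poly"
  define k where "k = pcompose h ?r"
  have k': "pderiv k = - pcompose (pderiv h) ?r"
    by (simp add: k_def pderiv_pcompose pderiv_pCons)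
  have "pcompose g ?r = [:m:] - ([:0, 1:] * k - pderiv k)"
    unfolding h k' by (simp add: pcompose_add pcompose_diff pcompose_mult k_def pcompose_pCons)
  then have "[:m:] - ([:0, 1:] * k - pderiv k) = [:m:] + ([:0, 1:] * h - pderiv h)"
    using g h by (simp only:)
  then have "([:0, 1:] * k - pderiv k) + ([:0, 1:] * h - pderiv h) = 0"
    by (metis (no_types) add_diff_cancel_left' diff_add_eq_diff_diff_swap diff_self
        eq_iff_diff_eq_0 minus_diff_eq add.commute uminus_add_conv_diff)
  then have "[:0, 1:] * (k + h) - pderiv (k + h) = 0"
    by (simp only: pderiv_add distrib_left add_diff_add)
  then have "k + h = 0"
    by (rule stein_operator_inj)
  then show ?thesis
    by (simp add: k_def eq_neg_iff_add_eq_0)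
qed

text \<open>
  The polynomials \<open>G\<close> are the \<open>g\<^sub>n + p\<^sub>n(Y)\<close> of the algebraic Stein operator recursion: each step
  integrates by parts and trades \<open>f\<^sup>(\<^sup>n\<^sup>)\<close> for \<open>f\<^sup>(\<^sup>n\<^sup>+\<^sup>1\<^sup>)\<close>.
\<close>

lemma (in real_subring) stein_recursion:
  assumes H: "H \<in> polys" and c: "\<And>t. t \<le> T \<Longrightarrow> c t \<in> polys" and "n \<le> T"
  shows "\<exists>G m. \<exists>r\<in>polys. G = pderiv H * r + pcompose (c n) H \<and>
    (pcompose H [:0, -1:] = H \<longrightarrow> pcompose G [:0, -1:] = G) \<and>
    (\<forall>f. deriv_chain T f \<longrightarrow>
      (\<Sum>t\<le>n. gauss_mean (\<lambda>x. poly (c t) (poly H x) * f t (poly H x))) =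
      (\<Sum>t<n. m t * gauss_mean (\<lambda>x. f t (poly H x))) + gauss_mean (\<lambda>x. poly G x * f n (poly H x)))"
  using \<open>n \<le> T\<close>
proof (induction n)
  case 0
  show ?case
    by (rule exI[of _ "pcompose (c 0) H"], rule exI, rule bexI[OF _ polys_0])
      (simp add: poly_pcompose flip: pcompose_assoc)
next
  case (Suc n)
  let ?r = "[:0, -1:] :: real poly"
  obtain G m r where r: "r \<in> polys" "G = pderiv H * r + pcompose (c n) H"
    and G_even: "pcompose H ?r = H \<Longrightarrow> pcompose G ?r = G"
    and G: "\<And>f. deriv_chain T f \<Longrightarrow>
      (\<Sum>t\<le>n. gauss_mean (\<lambda>x. poly (c t) (poly H x) * f t (poly H x))) =
      (\<Sum>t<n. m t * gauss_mean (\<lambda>x. f t (poly H x))) + gauss_mean (\<lambda>x. poly G x * f n (poly H x))"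
    using Suc by (auto simp del: mult_pCons_left)
  have "G \<in> polys"
    unfolding r(2) using r(1) H c[of n] Suc.prems
    by (intro polys_add polys_mult polys_pderiv polys_pcompose) auto
  then obtain m' h where h: "h \<in> polys" "G = [:m':] + ([:0, 1:] * h - pderiv h)"
    by (rule stein_decomposition)
  define G' where "G' = pderiv H * h + pcompose (c (Suc n)) H"
  have "pcompose G' ?r = G'" if "pcompose H ?r = H"
  proof -
    have "pcompose h ?r = - h"
      using stein_decomposition_parity[OF G_even[OF that] h(2)] .
    moreover have "pcompose (pderiv H) ?r = - pderiv H"
      using pderiv_pcompose[of H ?r] that by (simp add: pderiv_pCons)
    ultimately show ?thesis
      by (simp add: G'_def pcompose_add pcompose_mult that flip: pcompose_assoc)
  qed
  moreover have "(\<Sum>t\<le>Suc n. gauss_mean (\<lambda>x. poly (c t) (poly H x) * f t (poly H x))) =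
      (\<Sum>t<Suc n. (m(n := m')) t * gauss_mean (\<lambda>x. f t (poly H x))) +
      gauss_mean (\<lambda>x. poly G' x * f (Suc n) (poly H x))" if f: "deriv_chain T f" for f
  proof -
    have deriv: "(f n has_real_derivative f (Suc n) y) (at y)" for y
      using f Suc.prems by (simp add: deriv_chain_def)
    have bd: "poly_bounded (\<lambda>x. f n (poly H x))" "poly_bounded (\<lambda>x. f (Suc n) (poly H x))"
      using f Suc.prems by (auto simp: deriv_chain_def intro: poly_bounded_compose)
    have "gauss_mean (\<lambda>x. poly G x * f n (poly H x)) =
        gauss_mean (\<lambda>x. m' * f n (poly H x) + poly ([:0, 1:] * h - pderiv h) x * f n (poly H x))"
      unfolding h(2) by (simp add: algebra_simps)
    also have "\<dots> = m' * gauss_mean (\<lambda>x. f n (poly H x)) +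
        gauss_mean (\<lambda>x. poly ([:0, 1:] * h - pderiv h) x * f n (poly H x))"
      by (subst gauss_mean_add)
        (auto simp only: gauss_mean_cmult intro!: poly_bounded_mult poly_bounded_poly poly_bounded_const bd)
    \<comment> \<open>The chain rule produces the factor H', which places the new polynomial in the
      required coset of the ideal.\<close>
    also have "gauss_mean (\<lambda>x. poly ([:0, 1:] * h - pderiv h) x * f n (poly H x)) =
        gauss_mean (\<lambda>x. poly h x * (f (Suc n) (poly H x) * poly (pderiv H) x))"
      by (intro gauss_mean_by_parts poly_bounded_mult poly_bounded_poly bd DERIV_chain2[OF deriv] poly_DERIV)
    finally have step: "gauss_mean (\<lambda>x. poly G x * f n (poly H x)) = m' * gauss_mean (\<lambda>x. f n (poly H x)) +
        gauss_mean (\<lambda>x. poly h x * (f (Suc n) (poly H x) * poly (pderiv H) x))" .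
    have "gauss_mean (\<lambda>x. poly G' x * f (Suc n) (poly H x)) =
        gauss_mean (\<lambda>x. poly h x * (f (Suc n) (poly H x) * poly (pderiv H) x) +
          poly (c (Suc n)) (poly H x) * f (Suc n) (poly H x))"
      by (simp add: G'_def poly_pcompose algebra_simps)
    also have "\<dots> = gauss_mean (\<lambda>x. poly h x * (f (Suc n) (poly H x) * poly (pderiv H) x)) +
        gauss_mean (\<lambda>x. poly (c (Suc n)) (poly H x) * f (Suc n) (poly H x))"
      by (intro gauss_mean_add poly_bounded_mult poly_bounded_poly bd
          poly_bounded_compose[OF poly_bounded_poly])
    finally show ?thesis
      using G[OF f] step by simp
  qed
  ultimately show ?case
    using h(1) unfolding G'_def by blast
qed

text \<open>Divided powers: the derivative of order \<open>s\<close> is 1 and all later ones vanish,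
  which isolates the \<open>s\<close>-th constant of the recursion.\<close>

lemma deriv_chain_powers:
  "deriv_chain T (\<lambda>t y. if t \<le> s then y ^ (s - t) / fact (s - t) else 0)"
proof -
  define e :: "nat \<Rightarrow> real \<Rightarrow> real" where "e = (\<lambda>n y. y ^ n / fact n)"
  have e_deriv: "(e (Suc n) has_real_derivative e n y) (at y)" for n y
  proof -
    have "(e (Suc n) has_real_derivative (of_nat (Suc n) * y ^ n) / fact (Suc n)) (at y)"
      unfolding e_def using DERIV_pow[of "Suc n" y] by (intro DERIV_cdivide) simp
    moreover have "(of_nat (Suc n) * y ^ n) / fact (Suc n) = e n y"
      by (simp add: e_def divide_simps del: of_nat_Suc)
    ultimately show ?thesis
      by simp
  qed
  have e_bounded: "poly_bounded (e n)" for n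
  proof -
    have "e n = poly (monom (1 / fact n) n)"
      by (simp add: e_def fun_eq_iff poly_monom)
    then show ?thesis
      by (simp only: poly_bounded_poly)
  qed
  have "((\<lambda>y. if t \<le> s then e (s - t) y else 0) has_real_derivative
      (if Suc t \<le> s then e (s - Suc t) y else 0)) (at y)" for t y
  proof -
    consider "t < s" | "t = s" | "t > s"
      by linarith
    then show ?thesis
    proof cases
      case 1
      then have "s - t = Suc (s - Suc t)"
        by simp
      then show ?thesis
        using 1 e_deriv[of "s - Suc t" y] by simp
    qed (simp_all add: e_def)
  qed
  moreover have "poly_bounded (\<lambda>y. if t \<le> s then e (s - t) y else 0)" for t
    using e_bounded[of "s - t"] poly_bounded_const[of 0] by (cases "t \<le> s") simp_all
  ultimately have "deriv_chain T (\<lambda>t y. if t \<le> s then e (s - t) y else 0)"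
    unfolding deriv_chain_def by blast
  then show ?thesis
    by (simp only: e_def)
qed

lemma DERIV_max_power:
  fixes R y :: real
  assumes "k > 0"
  shows "((\<lambda>y. max 0 (y - R) ^ Suc k) has_real_derivative of_nat (Suc k) * max 0 (y - R) ^ k) (at y)"
proof -
  consider "y < R" | "y = R" | "y > R"
    by linarith
  then show ?thesis
  proof cases
    case 1
    have "of_nat (Suc k) * max 0 (y - R) ^ k = 0"
      using 1 assms by (simp add: max_def)
    then have "((\<lambda>y. 0) has_real_derivative of_nat (Suc k) * max 0 (y - R) ^ k) (at y)"
      by (simp only: DERIV_const)
    then show ?thesis
      by (rule has_field_derivative_transform_within_open[of _ _ _ "{..<R}"]) (use 1 in auto)
  next
    case 2
    \<comment> \<open>At the kink the difference quotient is \<open>max 0 (z - R) ^ k\<close>,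
      continuous with value 0 because \<open>k > 0\<close>; Caratheodory's criterion
      applies.\<close>
    have "max 0 (z - R) ^ Suc k - max 0 (y - R) ^ Suc k = max 0 (z - R) ^ k * (z - y)" for z
      using 2 assms by (auto simp: max_def)
    moreover have "isCont (\<lambda>z. max 0 (z - R) ^ k) y"
      by (intro continuous_intros)
    moreover have "max 0 (y - R) ^ k = of_nat (Suc k) * max 0 (y - R) ^ k"
      using 2 assms by simp
    ultimately show ?thesis
      unfolding CARAT_DERIV by (intro exI[of _ "\<lambda>z. max 0 (z - R) ^ k"] conjI allI)
  next
    case 3
    have "((\<lambda>y. (y - R) ^ Suc k) has_real_derivative of_nat (Suc k) * max 0 (y - R) ^ k) (at y)"
      using 3 by (auto intro!: derivative_eq_intros simp del: power_Suc)
    then show ?thesis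
      by (rule has_field_derivative_transform_within_open[of _ _ _ "{R<..}"]) (use 3 in auto)
  qed
qed

lemma poly_bounded_max: "poly_bounded (\<lambda>y. max 0 (y - R))"
proof (rule poly_boundedI)
  fix y :: real
  have "\<bar>y - R\<bar> \<le> 1 + (y - R)\<^sup>2"
    by (rule abs_le_one_plus_square)
  moreover have "1 + (y - R)\<^sup>2 = poly (1 + [:- R, 1:] * [:- R, 1:]) y"
    by (simp add: power2_eq_square algebra_simps)
  ultimately show "\<bar>max 0 (y - R)\<bar> \<le> poly (1 + [:- R, 1:] * [:- R, 1:]) y"
    by linarith
qed (intro continuous_intros)

text \<open>The exponent is chosen so that the derivative of order \<open>T\<close> is exactly the
  positive part of y - R, which only has to be continuous.\<close>

lemma deriv_chain_max:
  "deriv_chain T (\<lambda>t y. max 0 (y - R) ^ Suc (T - t) / fact (Suc (T - t)))"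
proof -
  have "((\<lambda>y. max 0 (y - R) ^ Suc (T - t) / fact (Suc (T - t))) has_real_derivative
      max 0 (y - R) ^ Suc (T - Suc t) / fact (Suc (T - Suc t))) (at y)" if "t < T" for t y
  proof -
    define k where "k = T - t"
    have k: "Suc (T - Suc t) = k" "k > 0"
      using that by (auto simp: k_def)
    have "((\<lambda>y. max 0 (y - R) ^ Suc k / fact (Suc k)) has_real_derivative
        (of_nat (Suc k) * max 0 (y - R) ^ k) / fact (Suc k)) (at y)"
      by (intro DERIV_cdivide DERIV_max_power k)
    moreover have "(of_nat (Suc k) * max 0 (y - R) ^ k) / fact (Suc k) = max 0 (y - R) ^ k / fact k"
      by (simp add: divide_simps del: of_nat_Suc)
    ultimately show ?thesis
      unfolding k(1) k_def[symmetric] by simp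
  qed
  moreover have "poly_bounded (\<lambda>y. max 0 (y - R) ^ Suc (T - t) / fact (Suc (T - t)))" for t
    using poly_bounded_mult[OF poly_bounded_power[OF poly_bounded_max, of R "Suc (T - t)"]
        poly_bounded_const[of "1 / fact (Suc (T - t))"]] by simp
  ultimately show ?thesis
    unfolding deriv_chain_def by blast
qed

text \<open>
  Large values of \<open>H\<close> are attained only far from the origin, where \<open>G\<close> has a constant sign, so
  testing with \<open>(y - R)\<^sub>+\<close> for large \<open>R\<close> detects \<open>G\<close>.
\<close>

lemma gauss_mean_test_zero:
  fixes G H :: "real poly"
  assumes H: "lead_coeff H > 0" "degree H > 0"
    and parity: "pcompose H [:0, -1:] = H \<and> pcompose G [:0, -1:] = G \<or> pcompose H [:0, -1:] = - H"
    and test: "\<And>R. gauss_mean (\<lambda>x. poly G x * max 0 (poly H x - R)) = 0"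
  shows "G = 0"
proof -
  \<comment> \<open>A positive leading coefficient is refuted here; applying this to
    \<open>- G\<close> excludes a negative one.\<close>
  have *: False
    if lc: "lead_coeff G > 0"
      and parity: "pcompose H [:0, -1:] = H \<and> pcompose G [:0, -1:] = G \<or> pcompose H [:0, -1:] = - H"
      and test: "\<And>R. gauss_mean (\<lambda>x. poly G x * max 0 (poly H x - R)) = 0" for G
  proof -
    obtain a where a: "\<And>x. x \<ge> a \<Longrightarrow> poly G x > 0"
      using poly_pinfty_gt_lc[OF lc] lc by (meson less_le_trans)
    obtain b where b: "\<And>x. x \<ge> b \<Longrightarrow> poly H x > 0"
      using poly_pinfty_gt_lc[OF H(1)] H(1) by (meson less_le_trans)
    define x0 where "x0 = max 0 (max a b)"
    have "bounded (poly H ` {- x0..x0})"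
      by (intro compact_imp_bounded compact_continuous_image continuous_intros) auto
    then obtain R where R: "R > 0" "\<And>x. x \<in> {- x0..x0} \<Longrightarrow> \<bar>poly H x\<bar> \<le> R"
      unfolding bounded_pos by auto
    have nonneg: "0 \<le> poly G x * max 0 (poly H x - R)" for x
    proof (cases "poly H x \<le> R")
      case False
      then have "\<not> x \<in> {- x0..x0}"
        using R(2)[of x] by auto
      then consider "x > x0" | "- x > x0"
        by fastforce
      then have "poly G x > 0"
      proof cases
        case 1
        then show ?thesis
          using a by (simp add: x0_def)
      next
        case 2
        \<comment> \<open>Far to the left, either both polynomials are even and \<open>G\<close> is
          positive by reflection, or \<open>H\<close> is odd, hence negative, contradicting a value
          above \<open>R\<close>.\<close>
        have minus: "poly (pcompose q [:0, -1:]) x = poly q (- x)" for q :: "real poly"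
          by (simp add: poly_pcompose)
        have "poly H (- x) > 0" "poly G (- x) > 0"
          using 2 a[of "- x"] b[of "- x"] by (auto simp: x0_def)
        moreover have "poly H (- x) = - poly H x \<Longrightarrow> False"
          using False R(1) calculation(1) by linarith
        ultimately show ?thesis
          using parity minus[of G] minus[of H] by (metis poly_minus)
      qed
      then show ?thesis
        by simp
    qed (simp add: max_def)
    have bd: "poly_bounded (\<lambda>x. poly G x * max 0 (poly H x - R))"
      by (intro poly_bounded_mult poly_bounded_poly poly_bounded_compose[OF poly_bounded_max])
    have zero: "poly G x * max 0 (poly H x - R) = 0" for x
      by (rule gauss_mean_zeroD[OF bd nonneg test])
    have "lead_coeff (H - [:R:]) > 0"
      using H by (cases H) (auto split: if_splits)
    then obtain d where d: "\<And>x. x \<ge> d \<Longrightarrow> poly (H - [:R:]) x > 0"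
      using poly_pinfty_gt_lc by (meson less_le_trans)
    show False
      using zero[of "max a d"] a[of "max a d"] d[of "max a d"] by simp
  qed
  have "\<not> lead_coeff G > 0"
    using *[of G] parity test by blast
  moreover have "\<not> lead_coeff (- G) > 0"
    using *[of "- G"] parity gauss_mean_cmult[of "-1" "\<lambda>x. poly G x * max 0 (poly H x - R)" for R] test
    by (auto simp: pcompose_uminus)
  ultimately show "G = 0"
    by simp
qed

lemma (in real_subring) stein_leading_coefficient:
  assumes H: "H \<in> polys" "lead_coeff H > 0" "degree H > 0"
    and parity: "pcompose H [:0, -1:] = H \<or> pcompose H [:0, -1:] = - H"
    and c: "\<And>t. t \<le> T \<Longrightarrow> c t \<in> polys"
    and zero: "\<And>f. deriv_chain T f \<Longrightarrow>
      (\<Sum>t\<le>T. gauss_mean (\<lambda>x. poly (c t) (poly H x) * f t (poly H x))) = 0"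
  shows "\<exists>r\<in>polys. pcompose (c T) H = pderiv H * r"
proof -
  obtain G m r where r: "r \<in> polys" "G = pderiv H * r + pcompose (c T) H"
    and G_even: "pcompose H [:0, -1:] = H \<Longrightarrow> pcompose G [:0, -1:] = G"
    and G: "\<And>f. deriv_chain T f \<Longrightarrow>
      (\<Sum>t\<le>T. gauss_mean (\<lambda>x. poly (c t) (poly H x) * f t (poly H x))) =
      (\<Sum>t<T. m t * gauss_mean (\<lambda>x. f t (poly H x))) + gauss_mean (\<lambda>x. poly G x * f T (poly H x))"
    using stein_recursion[of H T c T, OF H(1) c order_refl] by blast
  have G0: "(\<Sum>t<T. m t * gauss_mean (\<lambda>x. f t (poly H x))) + gauss_mean (\<lambda>x. poly G x * f T (poly H x)) = 0"
    if "deriv_chain T f" for f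
    using G[OF that] zero[OF that] by simp
  \<comment> \<open>The divided power of degree \<open>s\<close> gives a triangular system: earlier
    constants vanish by induction, later derivatives are zero, including the one of order
    \<open>T\<close>.\<close>
  have m: "m s = 0" if "s < T" for s
    using that
  proof (induction s rule: less_induct)
    case (less s)
    define f :: "nat \<Rightarrow> real \<Rightarrow> real"
      where "f = (\<lambda>t y. if t \<le> s then y ^ (s - t) / fact (s - t) else 0)"
    have "m t * gauss_mean (\<lambda>x. f t (poly H x)) = (if t = s then m s else 0)" if "t < T" for t
    proof (cases "t < s")
      case True
      then show ?thesis
        using less.IH[of t] that by simp
    next
      case False
      then show ?thesis
        by (cases "t = s") (auto simp: f_def gauss_mean_const)
    qed
    then have "(\<Sum>t<T. m t * gauss_mean (\<lambda>x. f t (poly H x))) = (\<Sum>t<T. if t = s then m s else 0)"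
      by (intro sum.cong) auto
    also have "\<dots> = m s"
      using less.prems by simp
    finally show ?case
      using G0[of f] deriv_chain_powers[of T s] less.prems by (simp add: f_def gauss_mean_const)
  qed
  have "gauss_mean (\<lambda>x. poly G x * max 0 (poly H x - R)) = 0" for R
    using G0[OF deriv_chain_max[of T R]] m by simp
  then have "G = 0"
    using parity G_even by (intro gauss_mean_test_zero[OF H(2,3)]) auto
  then have "pcompose (c T) H = pderiv H * (- r)"
    using r(2) by (simp add: eq_neg_iff_add_eq_0 add.commute)
  then show ?thesis
    using polys_uminus[OF r(1)] by blast
qed

section \<open>The support of the target and the passage from expectations to Gaussian
  integrals\<close>

locale std_normal_variable = prob_space M for M :: "'a measure" +
  fixes X :: "'a \<Rightarrow> real"
  assumes X: "distributed M lborel X std_normal_density"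
begin

lemma X_measurable [measurable]: "X \<in> borel_measurable M"
  using distributed_measurable[OF X] by simp

lemma integrable_poly_bounded: "poly_bounded v \<Longrightarrow> integrable M (\<lambda>\<omega>. v (X \<omega>))"
  and expectation_poly_bounded: "poly_bounded v \<Longrightarrow> (\<integral>\<omega>. v (X \<omega>) \<partial>M) = gauss_mean v"
proof -
  assume v: "poly_bounded v"
  then have [measurable]: "v \<in> borel_measurable borel"
    by (intro borel_measurable_continuous_onI) (simp add: poly_bounded_def)
  show "integrable M (\<lambda>\<omega>. v (X \<omega>))"
    using distributed_integrable[OF X, of v] integrable_std_normal_poly_bounded[OF v] by simp
  show "(\<integral>\<omega>. v (X \<omega>) \<partial>M) = gauss_mean v"
    using distributed_integral[OF X, of v] by (simp add: gauss_mean_def)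
qed

lemma range_subset_rv_support:
  "range (poly H) \<subseteq> rv_support M (\<lambda>\<omega>. poly H (X \<omega>))"
proof (clarsimp simp: rv_support_def)
  fix x e :: real assume e: "e > 0"
  let ?A = "{\<omega> \<in> space M. dist (poly H x) (poly H (X \<omega>)) < e}"
  \<comment> \<open>A tent of height \<open>e\<close> that vanishes off the event: if the event were
    null, the tent would have mean zero and thus vanish at \<open>x\<close>.\<close>
  define v where "v = (\<lambda>y. max 0 (e - \<bar>poly H y - poly H x\<bar>))"
  have [measurable]: "poly H \<in> borel_measurable borel"
    by (intro borel_measurable_continuous_onI continuous_intros)
  have "poly_bounded v"
  proof (rule poly_boundedI[of _ "[:e:]"])
    show "continuous_on UNIV v"
      unfolding v_def by (intro continuous_intros)
  qed (use e in \<open>auto simp: v_def\<close>)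
  show "0 < measure M ?A"
  proof (rule ccontr)
    assume "\<not> 0 < measure M ?A"
    then have "measure M ?A = 0"
      using measure_nonneg[of M ?A] by linarith
    then have "AE \<omega> in M. \<not> dist (poly H x) (poly H (X \<omega>)) < e"
      by (subst (asm) prob_eq_0) auto
    then have "AE \<omega> in M. v (X \<omega>) = 0"
      by eventually_elim (auto simp: v_def dist_real_def)
    then have "(\<integral>\<omega>. v (X \<omega>) \<partial>M) = 0"
      by (rule integral_eq_zero_AE)
    then have "gauss_mean v = 0"
      using expectation_poly_bounded[OF \<open>poly_bounded v\<close>] by simp
    then have "v x = 0"
      by (intro gauss_mean_zeroD[OF \<open>poly_bounded v\<close>]) (auto simp: v_def)
    then show False
      using e by (simp add: v_def)
  qed
qed

lemma rv_support_subset_closure: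
  "rv_support M (\<lambda>\<omega>. poly H (X \<omega>)) \<subseteq> closure (range (poly H))"
proof
  fix y assume y: "y \<in> rv_support M (\<lambda>\<omega>. poly H (X \<omega>))"
  show "y \<in> closure (range (poly H))"
    unfolding closure_approachable
  proof (intro allI impI)
    fix e :: real assume "e > 0"
    then have "measure M {\<omega> \<in> space M. poly H (X \<omega>) \<in> ball y e} > 0"
      using y by (simp add: rv_support_def)
    then have "{\<omega> \<in> space M. poly H (X \<omega>) \<in> ball y e} \<noteq> {}"
      by (metis less_irrefl measure_empty)
    then show "\<exists>z\<in>range (poly H). dist z y < e"
      by (auto simp: dist_commute)
  qed
qed

text \<open>The support lies between the connected range and its closure and is not a single point,
  so it has no isolated points. Derivatives within it are therefore unique.\<close>

lemma rv_support_islimpt: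
  assumes "degree H > 0" "y \<in> rv_support M (\<lambda>\<omega>. poly H (X \<omega>))"
  shows "y islimpt rv_support M (\<lambda>\<omega>. poly H (X \<omega>))"
proof (rule connected_imp_perfect[OF _ assms(2)])
  have "connected (range (poly H))"
    by (intro connected_continuous_image continuous_intros) auto
  then show "connected (rv_support M (\<lambda>\<omega>. poly H (X \<omega>)))"
    by (rule connected_intermediate_closure[OF _ range_subset_rv_support rv_support_subset_closure])
  fix a show "rv_support M (\<lambda>\<omega>. poly H (X \<omega>)) \<noteq> {a}"
  proof
    assume "rv_support M (\<lambda>\<omega>. poly H (X \<omega>)) = {a}"
    then have "poly H x = poly [:a:] x" for x
      using range_subset_rv_support[of H] by auto
    then have "H = [:a:]"
      by (intro poly_ext)
    then show False
      using assms(1) by simp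
  qed
qed

lemma PSO_gauss_mean:
  assumes pso: "PSO M (\<lambda>\<omega>. poly H (X \<omega>)) T c" and H: "degree H > 0" and f: "deriv_chain T f"
  shows "(\<Sum>t\<le>T. gauss_mean (\<lambda>x. poly (c t) (poly H x) * f t (poly H x))) = 0"
proof -
  let ?Y = "\<lambda>\<omega>. poly H (X \<omega>)"
  define I where "I = rv_support M ?Y"
  have Y: "?Y \<omega> \<in> I" for \<omega>
    using range_subset_rv_support by (auto simp: I_def)
  have nontriv: "at y within I \<noteq> bot" if "y \<in> I" for y
    using rv_support_islimpt[OF H] that by (simp add: I_def trivial_limit_within)
  have deriv: "(f t has_derivative (*) (f (Suc t) y)) (at y within I)" if "t < T" for t y
    using f that unfolding deriv_chain_def has_field_derivative_def
    by (blast intro: has_derivative_at_withinI)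
  \<comment> \<open>On the support, one-sided end points included, the iterated derivatives within
    \<open>I\<close> agree with the globally defined chain.\<close>
  have hd: "\<forall>y\<in>I. higher_deriv_on I t (f 0) y = f t y" if "t \<le> T" for t
    using that
  proof (induction t)
    case (Suc t)
    have "vector_derivative (higher_deriv_on I t (f 0)) (at y within I) = f (Suc t) y"
      if "y \<in> I" for y
    proof (rule vector_derivative_within[OF nontriv[OF that]])
      have "(higher_deriv_on I t (f 0) has_derivative (*) (f (Suc t) y)) (at y within I)"
        by (rule has_derivative_transform[OF that _ deriv]) (use Suc in auto)
      then show "(higher_deriv_on I t (f 0) has_vector_derivative f (Suc t) y) (at y within I)"
        unfolding has_real_derivative_iff_has_vector_derivative[symmetric] has_field_derivative_def .
    qed
    then show ?case
      by simp
  qed simp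
  have bd: "poly_bounded (\<lambda>x. f t (poly H x))" if "t \<le> T" for t
    using f that by (auto simp: deriv_chain_def intro: poly_bounded_compose)
  have "f 0 \<in> C_on T I"
    unfolding C_on_def
  proof (intro CollectI conjI allI impI)
    fix t assume t: "t < T"
    show "higher_deriv_on I t (f 0) differentiable_on I"
      unfolding differentiable_on_def differentiable_def
    proof
      fix y assume "y \<in> I"
      then have "(higher_deriv_on I t (f 0) has_derivative (*) (f (Suc t) y)) (at y within I)"
        by (rule has_derivative_transform[OF _ _ deriv]) (use hd t in auto)
      then show "\<exists>D. (higher_deriv_on I t (f 0) has_derivative D) (at y within I)"
        by blast
    qed
  next
    have "continuous_on I (f T)"
      using f by (auto simp: deriv_chain_def poly_bounded_def intro: continuous_on_subset)
    then show "continuous_on I (higher_deriv_on I T (f 0))"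
      using hd by (simp cong: continuous_on_cong)
  qed
  moreover have "integrable M (\<lambda>\<omega>. ?Y \<omega> ^ j * higher_deriv_on I t (f 0) (?Y \<omega>))" if "t \<le> T" for t j
  proof -
    have "poly_bounded (\<lambda>x. poly H x ^ j * f t (poly H x))"
      by (intro poly_bounded_mult poly_bounded_power poly_bounded_poly bd that)
    from integrable_poly_bounded[OF this] show ?thesis
      using hd[OF that] Y by simp
  qed
  ultimately have "f 0 \<in> stein_class M ?Y T c"
    by (simp add: stein_class_def I_def)
  then have "(\<integral>\<omega>. apply_op I T c (f 0) (?Y \<omega>) \<partial>M) = 0"
    using pso by (simp add: PSO_def I_def)
  also have "(\<lambda>\<omega>. apply_op I T c (f 0) (?Y \<omega>)) =
      (\<lambda>\<omega>. \<Sum>t\<le>T. poly (c t) (?Y \<omega>) * f t (?Y \<omega>))"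
    unfolding apply_op_def using hd Y by (intro ext sum.cong) auto
  finally have "gauss_mean (\<lambda>x. \<Sum>t\<le>T. poly (c t) (poly H x) * f t (poly H x)) = 0"
    by (subst expectation_poly_bounded[symmetric])
      (auto intro!: poly_bounded_sum poly_bounded_mult bd poly_bounded_compose[OF poly_bounded_poly])
  then show ?thesis
    by (subst (asm) gauss_mean_sum)
      (auto intro!: poly_bounded_mult bd poly_bounded_compose[OF poly_bounded_poly])
qed

end

lemma pcompose_hermite_minus:
  "pcompose (hermite n) [:0, -1:] = (if even n then hermite n else - hermite n)"
  by (rule poly_ext) (simp add: poly_pcompose poly_hermite_minus)

theorem proposition4p1:
  fixes M :: "'a measure" and X Y :: "'a \<Rightarrow> real" and K :: "real set" and p :: nat
  assumes "prob_space M"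
    and "distributed M lborel X std_normal_density"
    and "Y = (\<lambda>\<omega>. poly (hermite p) (X \<omega>))"
    and "p \<ge> 2"
    and "K = \<int> \<or> K = \<rat> \<or> K = (UNIV :: real set)"
  shows
    "(ideal (critical_ideal K p) (poly_ring K) \<and>
      critical_poly p \<in> carrier (poly_ring K) \<and>
      (K \<noteq> \<int> \<longrightarrow> critical_ideal K p = Idl\<^bsub>poly_ring K\<^esub> {critical_poly p}) \<and>
      (K = \<int> \<longrightarrow> critical_ideal K p = Idl\<^bsub>poly_ring K\<^esub> {smult (of_nat p) (critical_poly p)})) \<and>
     (\<forall>(T :: nat) (c :: nat \<Rightarrow> real poly).
        (\<forall>t\<le>T. c t \<in> carrier (poly_ring K)) \<and> c T \<noteq> 0 \<and> PSO M Y T c \<longrightarrow>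
          (c T \<in> critical_ideal K p \<and>
           (\<forall>x. poly (pderiv (hermite p)) x = 0 \<longrightarrow> poly (c T) (poly (hermite p) x) = 0) \<and>
           (\<forall>z. (\<forall>\<^sub>F x in nhds z. poly (hermite p) z \<le> poly (hermite p) x) \<or>
                (\<forall>\<^sub>F x in nhds z. poly (hermite p) x \<le> poly (hermite p) z) \<longrightarrow>
                poly (c T) (poly (hermite p) z) = 0)) \<and>
          (even p \<longrightarrow> real (degree (c T)) \<ge> real p / 2) \<and>
          (odd p \<longrightarrow> degree (c T) \<ge> p - 1))"
proof -
  interpret std_normal_variable M X
    using assms(1,2) by (simp add: std_normal_variable_def std_normal_variable_axioms_def)
  interpret real_subring K
    using assms(5) by unfold_locales auto
  obtain n where p: "p = Suc n" "n > 0"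
    using assms(4) by (cases p) auto
  let ?H = "hermite p"
  have inverse: "1 / of_nat (Suc n) \<in> K" if "K \<noteq> \<int>"
    using that assms(5) by auto
  have part_a: "ideal (critical_ideal K p) (poly_ring K) \<and> critical_poly p \<in> polys \<and>
      (K \<noteq> \<int> \<longrightarrow> critical_ideal K p = Idl\<^bsub>poly_ring K\<^esub> {critical_poly p}) \<and>
      (K = \<int> \<longrightarrow> critical_ideal K p = Idl\<^bsub>poly_ring K\<^esub> {smult (of_nat p) (critical_poly p)})"
    unfolding p(1) using ideal_critical_ideal critical_poly_mem critical_ideal_genideal
      critical_ideal_genideal_inverse inverse by blast
  have part_bc: "(c T \<in> critical_ideal K p \<and>
        (\<forall>x. poly (pderiv ?H) x = 0 \<longrightarrow> poly (c T) (poly ?H x) = 0) \<and>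
        (\<forall>z. (\<forall>\<^sub>F x in nhds z. poly ?H z \<le> poly ?H x) \<or>
             (\<forall>\<^sub>F x in nhds z. poly ?H x \<le> poly ?H z) \<longrightarrow> poly (c T) (poly ?H z) = 0)) \<and>
      (even p \<longrightarrow> real (degree (c T)) \<ge> real p / 2) \<and> (odd p \<longrightarrow> degree (c T) \<ge> p - 1)"
    if c: "\<And>t. t \<le> T \<Longrightarrow> c t \<in> polys" "c T \<noteq> 0" and pso: "PSO M Y T c" for T c
  proof -
    have H: "degree ?H > 0" "lead_coeff ?H > 0"
      unfolding degree_hermite lead_coeff_hermite using p by auto
    have "\<exists>r\<in>polys. pcompose (c T) ?H = pderiv ?H * r"
    proof (rule stein_leading_coefficient[where T = T and c = c, OF hermite_mem H(2,1) _ c(1)])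
      show "pcompose ?H [:0, -1:] = ?H \<or> pcompose ?H [:0, -1:] = - ?H"
        by (simp add: pcompose_hermite_minus)
      show "(\<Sum>t\<le>T. gauss_mean (\<lambda>x. poly (c t) (poly ?H x) * f t (poly ?H x))) = 0"
        if "deriv_chain T f" for f
        using PSO_gauss_mean[OF _ H(1) that] pso assms(3) by blast
    qed
    then obtain r where r: "r \<in> polys" "pcompose (c T) ?H = pderiv ?H * r"
      by blast
    have mem: "c T \<in> critical_ideal K p"
      unfolding critical_ideal_def genideal_poly_ring[OF polys_pderiv[OF hermite_mem]]
      using c(1)[of T] r by blast
    have zero: "poly (c T) (poly ?H x) = 0" if "poly (pderiv ?H) x = 0" for x
      using arg_cong[OF r(2), of "\<lambda>q. poly q x"] that by (simp add: poly_pcompose)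
    have extremum: "poly (pderiv ?H) z = 0"
      if "(\<forall>\<^sub>F x in nhds z. poly ?H z \<le> poly ?H x) \<or> (\<forall>\<^sub>F x in nhds z. poly ?H x \<le> poly ?H z)" for z
    proof -
      from that obtain d where "d > 0" "(\<forall>x. \<bar>z - x\<bar> < d \<longrightarrow> poly ?H z \<le> poly ?H x) \<or>
          (\<forall>x. \<bar>z - x\<bar> < d \<longrightarrow> poly ?H x \<le> poly ?H z)"
        unfolding eventually_nhds_metric dist_real_def by (metis abs_minus_commute)
      then show ?thesis
        using DERIV_local_min[OF poly_DERIV] DERIV_local_max[OF poly_DERIV] by metis
    qed
    obtain s where s: "c T = smult (of_nat (Suc n)) (critical_poly (Suc n) * s)"
      using mem unfolding p(1) critical_ideal_eq by blast
    have "critical_poly (Suc n) \<noteq> 0" "s \<noteq> 0"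
      using s c(2) by auto
    then have "degree (c T) = degree (critical_poly (Suc n)) + degree s"
      unfolding s by (simp add: degree_mult_eq del: of_nat_Suc)
    \<comment> \<open>For odd \<open>p\<close> all p - 1 critical values are distinct; for even
      \<open>p\<close> they number p/2.\<close>
    then have deg: "degree (c T) \<ge> (if even n then n else Suc n div 2)"
      by (simp add: degree_critical_poly)
    have "real (degree (c T)) \<ge> real p / 2" if "even p"
    proof -
      have "2 * degree (c T) \<ge> p"
        using deg that p by auto
      then show ?thesis
        by linarith
    qed
    then show ?thesis
      using mem zero extremum deg p by auto
  qed
  show ?thesis
    using part_a part_bc by blast
qed

end
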